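(* Reduction for $\mathsf{Catt}_{\mathsf{sua}}$ is strongly terminating: there is no infinite reduction sequence $s_0\leadsto s_1\leadsto s_2\leadsto\cdots$ starting from a well-typed term (or well-typed type, or well-typed substitution) $s_0$ of $\mathsf{Catt}_{\mathsf{sua}}$.
   Context: **Syntax.** Contexts, types, terms and substitutions are raw syntax up to renaming of variables; $\equiv$ is syntactic equality. A context is a list $x_1:A_1,\dots,x_k:A_k$ with $A_i$ a type over the preceding part. Types over $\Gamma$: $\star$, or $s\to_A t$ with $A$ a type and $s,t$ terms over $\Gamma$. Terms over $\Gamma$: variables of $\Gamma$, or $\mathsf{coh}(\Delta:A)[\sigma]$ with $\Delta$ a context, $A$ a type over $\Delta$, $\sigma:\Delta\to\Gamma$ a substitution. A substitution $\sigma:\Delta\to\Gamma$ assigns to each variable of $\Delta$ a term over $\Gamma$. Application $t[\![\sigma]\!]$, $A[\![\sigma]\!]$: variables are replaced, $\star[\![\sigma]\!]=\star$, $(s\to_A t)[\![\sigma]\!]=s[\![\sigma]\!]\to_{A[\![\sigma]\!]}t[\![\sigma]\!]$, $\mathsf{coh}(\Theta:A)[\tau][\![\sigma]\!]=\mathsf{coh}(\Theta:A)[\tau\circ\sigma]$, where for $\tau:\Theta\to\Delta$, $\sigma:\Delta\to\Gamma$ the composite $\tau\circ\sigma:\Theta\to\Gamma$ sends $x$ to $x[\![\tau]\!][\![\sigma]\!]$. $\dim(\star)=0$, $\dim(s\to_A t)=1+\dim A$; the dimension of a variable is that of its type; $\dim(\mathsf{coh}(\Delta:A)[\sigma])=\dim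 A$; $\dim\Gamma$ is the maximal dimension of its types. The support $\mathrm{supp}$ of a term, type or substitution over $\Gamma$ is its set of free variables in $\Gamma$ closed downwards (if $x:A$ in $\Gamma$ is included, so are the variables of $A$). **Trees.** A tree is a (possibly empty) finite list of trees $T=[T_1,\dots,T_n]$. $T^{[\,]}=T$, $T^{k::P}=(T_k)^P$. $\dim([\,])=0$, $\dim([T_1,\dots,T_n])=1+\max_k\dim T_k$. Trunk height: $\mathrm{th}([T_1])=1+\mathrm{th}(T_1)$, and $\mathrm{th}(T)=0$ if $T$ is not a one-element list. $T$ is linear if $\mathrm{th}(T)=\dim(T)$. Suspension $\Sigma$: $\Sigma\Gamma$ has new variables $N:\star,S:\star$ followed by $x:\Sigma A$ for each $x:A$ in $\Gamma$; $\Sigma\star=N\to_\star S$, $\Sigma(s\to_A t)=\Sigma s\to_{\Sigma A}\Sigma t$, $\Sigma x=x$, $\Sigma(\mathsf{coh}(\Delta:A)[\sigma])=\mathsf{coh}(\Sigma\Delta:\Sigma A)[\Sigma\sigma]$, and $\Sigma\sigma$ sends $N\mapsto N$, $S\mapsto S$, $x\mapsto\Sigma(x[\![\sigma]\!])$. Wedge $\Gamma\vee\Delta$: identify the last variable of type $\star$ of $\Gamma$ with the first variable of $\Delta$ (of type $\star$); substitutions preserving these points can be wedged. $\lfloor[\,]\rfloor$ is the context with one variable of type $\star$, and $\lfloor[T_1,\dots,T_n]\rfloor=\Sigma\lfloor T_1\rfloor\vee\dots\vee\Sigma\lfloor T_n\rfloor$. We write $T$ for $\lfloor T\rfloor$.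 A pasting context ($\Delta\vdash_p$) is a context of the form $\lfloor T\rfloor$. $D^n$ is the linear tree of dimension $n$; its context has a single $n$-dimensional variable $d_n$ and variables $d_k^-,d_k^+$ for $k<n$, with $d_0^\pm:\star$, $d_k^{\pm}:d_{k-1}^-\to d_{k-1}^+$ (and $d_n:d_{n-1}^-\to d_{n-1}^+$). For a type $A$ of dimension $n$ and a term $t$ over $\Gamma$, $\{A,t\}:D^n\to\Gamma$ sends $d_n\mapsto t$ and the $d_k^-,d_k^+$ to the successive sources and targets in $A$. Boundaries: $\partial_0T=[\,]$, $\partial_{n+1}[T_1,\dots,T_k]=[\partial_nT_1,\dots,\partial_nT_k]$; inclusions $\delta^{\epsilon,n}_T:\partial_nT\to T$ ($\epsilon\in\{-,+\}$): $\delta^{-,0}$ (resp. $\delta^{+,0}$) picks the first (resp. last) variable of type $\star$, and $\delta^{\epsilon,n+1}_T=\bigvee_i\Sigma\delta^{\epsilon,n}_{T_i}$. A labelling $L:T\to\Gamma$ of $T=[T_1,\dots,T_n]$ is a sequence $t_0L_1t_1\cdots L_nt_n$ with $t_i$ terms over $\Gamma$ and $L_i:T_i\to\Gamma$ labellings; substitutions $\lfloor T\rfloor\to\Gamma$ correspond to labellings ($t_i$ are the images of the $0$-dimensional variables, $L_i$ gives the images of the variables coming from $T_i$). **Standard constructions** for a pasting context $\Delta$: $\mathcal C^n_\Delta=\mathsf{coh}(\Delta:\mathcal U^n_\Delta)[\mathrm{id}]$; $\mathcal T^n_\Delta=d_n$ if $\Delta=D^n$, otherwise $\mathcal T^n_\Delta=\mathcal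 C^n_\Delta$; $\mathcal U^0_\Delta=\star$; $\mathcal U^{n+1}_\Delta=\mathcal T^n_{\partial_n\Delta}[\![\delta^{-,n}_\Delta]\!]\to_{\mathcal U^n_\Delta}\mathcal T^n_{\partial_n\Delta}[\![\delta^{+,n}_\Delta]\!]$. The identity on a term $s$ of type $A$, $\dim A=n$, is $\mathbb 1[\![\{A,s\}]\!]=\mathcal C^{n+1}_{D^n}[\![\{A,s\}]\!]$. **Insertion.** A branch $P$ of a tree $S$ is a non-empty index list such that the subtree $S^P$ is linear; $\lfloor P\rfloor$ is the variable of $\lfloor S\rfloor$ given by the unique locally maximal (top-dimensional) variable of $\lfloor S^P\rfloor$. Branch height $\mathrm{bh}(P)=\mathrm{length}(P)-1$; leaf height $\mathrm{lh}(P)=\dim\lfloor P\rfloor$. An insertion point is a triple $(S,P,T)$ with $S,T$ trees and $P$ a branch of $S$ with $\mathrm{bh}(P)\le\mathrm{th}(T)$ and $\mathrm{lh}(P)\ge\dim(T)$. With $S=[S_1,\dots,S_n]$: if $P=[k]$, then $S\ll_PT=[S_1,\dots,S_{k-1}]\mathbin{+\!+}T\mathbin{+\!+}[S_{k+1},\dots,S_n]$ (list concatenation); if $P=k::P'$ with $P'$ non-empty then $T=[T_1]$ and $S\ll_PT=[S_1,\dots,S_{k-1},\,S_k\ll_{P'}T_1,\,S_{k+1},\dots,S_n]$. Exterior substitution $\kappa_{S,P,T}:S\to S\ll_PT$: the wedge of identities on $[S_1,\dots,S_{k-1}]$ and $[S_{k+1},\dots,S_n]$ with, on the factor $\Sigma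 S_k$, the substitution $\{\mathcal U^{\mathrm{lh}(P)}_T,\mathcal C^{\mathrm{lh}(P)}_T\}:\Sigma S_k\to T$ if $P=[k]$ (here $\Sigma\lfloor S_k\rfloor=D^{\mathrm{lh}(P)}$), and $\Sigma\kappa_{S_k,P',T_1}$ if $P=k::P'$. Inserted substitution $\sigma\ll_P\tau:S\ll_PT\to\Gamma$ for $\sigma:S\to\Gamma$, $\tau:T\to\Gamma$ given by labellings $L=s_0L_1s_1\cdots L_ns_n$ and $M=t_0M_1t_1\cdots M_mt_m$: for $P=[k]$ it is $s_0L_1s_1\cdots L_{k-1}t_0M_1t_1\cdots M_mt_mL_{k+1}s_{k+1}\cdots L_ns_n$; for $P=k::P'$ (so $m=1$) it is $s_0L_1s_1\cdots L_{k-1}t_0(L_k\ll_{P'}M_1)t_1L_{k+1}s_{k+1}\cdots L_ns_n$. An insertion redex is $(S,P,T,\Gamma,\sigma,\tau)$ with $(S,P,T)$ an insertion point, $\sigma:S\to\Gamma$, $\tau:T\to\Gamma$, and $\lfloor P\rfloor[\![\sigma]\!]\equiv\mathcal C^{\mathrm{lh}(P)}_T[\![\tau]\!]$. **The theory $\mathsf{Catt}_{\mathsf{sua}}$.** Typing and equality are generated mutually. Typing: $\emptyset\vdash$; $\Gamma,(x:A)\vdash$ if $\Gamma\vdash$ and $\Gamma\vdash A$; $\Gamma\vdash\star$; $\Gamma\vdash s\to_At$ if $\Gamma\vdash A$, $\Gamma\vdash s:A$, $\Gamma\vdash t:A$; $\Gamma\vdash x:A$ if $\Gamma\vdash$ and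 $(x:A)\in\Gamma$; $\Delta\vdash\langle\rangle:\emptyset$; $\Delta\vdash\langle\sigma,x\mapsto t\rangle:(\Gamma,x:A)$ if $\Delta\vdash\sigma:\Gamma$, $\Gamma\vdash A$, $\Delta\vdash t:A[\![\sigma]\!]$; $\Gamma\vdash\mathsf{coh}(\Delta:s\to_At)[\sigma]:(s\to_At)[\![\sigma]\!]$ if $\Delta\vdash_p$, $\Delta\vdash s\to_At$, $\Gamma\vdash\sigma:\Delta$ and either $\mathrm{supp}(s)=\mathrm{supp}(\delta^{-,\dim\Delta-1}_\Delta)$ and $\mathrm{supp}(t)=\mathrm{supp}(\delta^{+,\dim\Delta-1}_\Delta)$, or $\mathrm{supp}(s)=\mathrm{supp}(t)=\Delta$; and conversion: $\Gamma\vdash s:B$ if $\Gamma\vdash s:A$ and $\Gamma\vdash A=B$. Equality (of terms, types, substitutions over $\Gamma$) is the equivalence relation generated by the congruence rules for all constructors (for coherences: $\Delta\vdash A=B$ and $\Gamma\vdash\sigma=\tau$ give $\Gamma\vdash\mathsf{coh}(\Delta:A)[\sigma]=\mathsf{coh}(\Delta:B)[\tau]$) together with $\Gamma\vdash s=t$ whenever $s$ is well-typed in $\Gamma$ and $(s,t)$ is an instance of: disc removal, $\mathcal C^n_{D^n}[\![\{A,u\}]\!]=u$; endo-coherence removal, $\mathsf{coh}(\Delta:u\to_Au)[\sigma]=\mathbb 1[\![\{A[\![\sigma]\!],u[\![\sigma]\!]\}]\!]$; insertion, $\mathsf{coh}(S:A)[\sigma]=\mathsf{coh}(S\ll_PT:A[\![\kappa_{S,P,T}]\!])[\sigma\ll_P\tau]$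 for insertion redexes $(S,P,T,\Gamma,\sigma,\tau)$. **Reduction.** One-step reduction $\leadsto$ on (well-typed) terms, types and substitutions: a term is an *identity* if it has the form $\mathcal C^{n+1}_{D^n}[\![\sigma]\!]$, a *disc* if it has the form $\mathcal C^n_{D^n}[\![\sigma]\!]$, a *standard composite* if it has the form $\mathcal C^{\dim T}_T[\![\tau]\!]$. Base rules (left to right): disc removal; endo-coherence removal when the left-hand side is not an identity; insertion when the left-hand side is not an identity or a disc and the inserted argument $\lfloor P\rfloor[\![\sigma]\!]$ is a standard composite or an identity. Structural rules: reduce inside exactly one place: $\mathsf{coh}(\Delta:A)[\sigma]\leadsto\mathsf{coh}(\Delta:B)[\sigma]$ if $A\leadsto B$ over $\Delta$; $\mathsf{coh}(\Delta:A)[\sigma]\leadsto\mathsf{coh}(\Delta:A)[\tau]$ if $\sigma\leadsto\tau$; $s\to_At$ reduces by reducing one of $s,A,t$; a substitution reduces by reducing one of its terms. *)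

theory Defs
  imports Main
begin

text \<open>
  Raw syntax up to renaming is represented with de Bruijn levels: a context is the list of the
  types of its variables, \<^term>\<open>i\<close> names its \<^term>\<open>i\<close>-th variable (counted from 0, oldest first),
  and a substitution \<open>\<Delta> \<rightarrow> \<Gamma>\<close> lists the images of the variables of \<open>\<Delta>\<close> in order.
  With levels, weakening is the identity on raw syntax.
\<close>

datatype ty = Star | Arr tm ty tm
     and tm = Var nat | Coh "ty list" ty "tm list"

type_synonym ctx = "ty list"
type_synonym sub = "tm list"

primrec ty_dim :: "ty \<Rightarrow> nat" where
  "ty_dim Star = 0"
| "ty_dim (Arr s A t) = Suc (ty_dim A)"

definition ctx_dim :: "ctx \<Rightarrow> nat" where
  "ctx_dim \<Gamma> = foldr max (map ty_dim \<Gamma>) 0"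

primrec sub_ty :: "ty \<Rightarrow> sub \<Rightarrow> ty" and sub_tm :: "tm \<Rightarrow> sub \<Rightarrow> tm" where
  "sub_ty Star \<sigma> = Star"
| "sub_ty (Arr s A t) \<sigma> = Arr (sub_tm s \<sigma>) (sub_ty A \<sigma>) (sub_tm t \<sigma>)"
| "sub_tm (Var i) \<sigma> = \<sigma> ! i"
| "sub_tm (Coh \<Theta> A \<tau>) \<sigma> = Coh \<Theta> A (map (\<lambda>t. sub_tm t \<sigma>) \<tau>)"

definition id_sub :: "ctx \<Rightarrow> sub" where
  "id_sub \<Gamma> = map Var [0..<length \<Gamma>]"

primrec fv_ty :: "ty \<Rightarrow> nat set" and fv_tm :: "tm \<Rightarrow> nat set" where
  "fv_ty Star = {}"
| "fv_ty (Arr s A t) = fv_tm s \<union> fv_ty A \<union> fv_tm t"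
| "fv_tm (Var i) = {i}"
| "fv_tm (Coh \<Theta> A \<tau>) = \<Union> (set (map fv_tm \<tau>))"

inductive_set down_closure :: "ctx \<Rightarrow> nat set \<Rightarrow> nat set" for \<Gamma> :: ctx and X :: "nat set" where
  base: "x \<in> X \<Longrightarrow> x \<in> down_closure \<Gamma> X"
| down: "x \<in> down_closure \<Gamma> X \<Longrightarrow> x < length \<Gamma> \<Longrightarrow> y \<in> fv_ty (\<Gamma> ! x) \<Longrightarrow> y \<in> down_closure \<Gamma> X"

definition supp_tm :: "ctx \<Rightarrow> tm \<Rightarrow> nat set" where
  "supp_tm \<Gamma> t = down_closure \<Gamma> (fv_tm t)"

definition supp_sub :: "ctx \<Rightarrow> sub \<Rightarrow> nat set" where
  "supp_sub \<Gamma> \<sigma> = down_closure \<Gamma> (\<Union> (set (map fv_tm \<sigma>)))"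


section \<open>Suspension and wedge\<close>

text \<open>The new variables \<open>N\<close> and \<open>S\<close> are the levels 0 and 1; all old levels move up by 2.\<close>

primrec susp_ty :: "ty \<Rightarrow> ty" and susp_tm :: "tm \<Rightarrow> tm" where
  "susp_ty Star = Arr (Var 0) Star (Var 1)"
| "susp_ty (Arr s A t) = Arr (susp_tm s) (susp_ty A) (susp_tm t)"
| "susp_tm (Var i) = Var (i + 2)"
| "susp_tm (Coh \<Delta> A \<sigma>) =
     Coh (Star # Star # map susp_ty \<Delta>) (susp_ty A) (Var 0 # Var 1 # map susp_tm \<sigma>)"

definition susp_ctx :: "ctx \<Rightarrow> ctx" where
  "susp_ctx \<Gamma> = Star # Star # map susp_ty \<Gamma>"

definition susp_sub :: "sub \<Rightarrow> sub" where
  "susp_sub \<sigma> = Var 0 # Var 1 # map susp_tm \<sigma>"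

definition last_pt :: "ctx \<Rightarrow> nat" where
  "last_pt \<Gamma> = last (filter (\<lambda>i. \<Gamma> ! i = Star) [0..<length \<Gamma>])"

text \<open>
  The wedge \<open>\<Gamma> \<or> \<Delta>\<close> lists the variables of \<open>\<Gamma>\<close> followed by those of \<open>\<Delta>\<close> except the first, which is
  identified with the last point of \<open>\<Gamma>\<close>. So the inclusion of \<open>\<Gamma>\<close> does not change levels, and
  \<open>wedge_inr \<Gamma>\<close> is the inclusion of \<open>\<Delta>\<close> on variables.
\<close>

definition wedge_inr :: "ctx \<Rightarrow> nat \<Rightarrow> nat" where
  "wedge_inr \<Gamma> j = (case j of 0 \<Rightarrow> last_pt \<Gamma> | Suc j' \<Rightarrow> length \<Gamma> + j')"

definition wedge_inr_sub :: "ctx \<Rightarrow> ctx \<Rightarrow> sub" where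
  "wedge_inr_sub \<Gamma> \<Delta> = map (\<lambda>j. Var (wedge_inr \<Gamma> j)) [0..<length \<Delta>]"

definition wedge :: "ctx \<Rightarrow> ctx \<Rightarrow> ctx" where
  "wedge \<Gamma> \<Delta> = \<Gamma> @ map (\<lambda>A. sub_ty A (wedge_inr_sub \<Gamma> \<Delta>)) (tl \<Delta>)"

text \<open>
  \<open>wedge_sub \<Gamma>' \<Delta>' \<sigma> \<tau>\<close> is the wedge \<open>\<Gamma> \<or> \<Delta> \<rightarrow> \<Gamma>' \<or> \<Delta>'\<close> of point-preserving substitutions
  \<open>\<sigma> : \<Gamma> \<rightarrow> \<Gamma>'\<close> and \<open>\<tau> : \<Delta> \<rightarrow> \<Delta>'\<close>.
\<close>

definition wedge_sub :: "ctx \<Rightarrow> ctx \<Rightarrow> sub \<Rightarrow> sub \<Rightarrow> sub" where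
  "wedge_sub \<Gamma>' \<Delta>' \<sigma> \<tau> = \<sigma> @ map (\<lambda>t. sub_tm t (wedge_inr_sub \<Gamma>' \<Delta>')) (tl \<tau>)"


section \<open>Trees and pasting contexts\<close>

datatype tree = Tree "tree list"

primrec tree_dim :: "tree \<Rightarrow> nat" where
  "tree_dim (Tree Ts) = (if Ts = [] then 0 else Suc (Max (set (map tree_dim Ts))))"

fun trunk_height :: "tree \<Rightarrow> nat" where
  "trunk_height (Tree [T]) = Suc (trunk_height T)"
| "trunk_height (Tree _) = 0"

definition linear :: "tree \<Rightarrow> bool" where
  "linear T \<longleftrightarrow> trunk_height T = tree_dim T"

primrec disc :: "nat \<Rightarrow> tree" where
  "disc 0 = Tree []"
| "disc (Suc n) = Tree [disc n]"

text \<open>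
  The one-point context is a strict unit for \<^const>\<open>wedge\<close> on the contexts below, so the iterated wedge may
  end in it.
\<close>

fun tree_ctx :: "tree \<Rightarrow> ctx" where
  "tree_ctx (Tree []) = [Star]"
| "tree_ctx (Tree (T # Ts)) = wedge (susp_ctx (tree_ctx T)) (tree_ctx (Tree Ts))"

definition pasting :: "ctx \<Rightarrow> bool" where
  "pasting \<Delta> \<longleftrightarrow> (\<exists>T. \<Delta> = tree_ctx T)"

fun bdry :: "nat \<Rightarrow> tree \<Rightarrow> tree" where
  "bdry 0 T = Tree []"
| "bdry (Suc n) (Tree Ts) = Tree (map (bdry n) Ts)"

datatype sign = Minus | Plus

fun bdry_incl :: "sign \<Rightarrow> nat \<Rightarrow> tree \<Rightarrow> sub" where
  "bdry_incl Minus 0 T = [Var 0]"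
| "bdry_incl Plus 0 T = [Var (last_pt (tree_ctx T))]"
| "bdry_incl \<epsilon> (Suc n) (Tree []) = [Var 0]"
| "bdry_incl \<epsilon> (Suc n) (Tree (T # Ts)) =
     wedge_sub (susp_ctx (tree_ctx T)) (tree_ctx (Tree Ts))
       (susp_sub (bdry_incl \<epsilon> n T)) (bdry_incl \<epsilon> (Suc n) (Tree Ts))"

text \<open>
  In \<open>tree_ctx (disc n)\<close> the variables are ordered \<open>d\<^sub>0\<^sup>-, d\<^sub>0\<^sup>+, d\<^sub>1\<^sup>-, d\<^sub>1\<^sup>+, \<dots>, d\<^sub>n\<close>, so that \<open>d\<^sub>n\<close> is
  level \<open>2 * n\<close>; \<open>disc_sub A t\<close> is the substitution \<open>{A, t}\<close>.
\<close>

primrec ty_spheres :: "ty \<Rightarrow> sub" where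
  "ty_spheres Star = []"
| "ty_spheres (Arr s A t) = ty_spheres A @ [s, t]"

definition disc_sub :: "ty \<Rightarrow> tm \<Rightarrow> sub" where
  "disc_sub A t = ty_spheres A @ [t]"


section \<open>Standard types, coherences and terms\<close>

fun std_ty :: "nat \<Rightarrow> tree \<Rightarrow> ty" and std_tm :: "nat \<Rightarrow> tree \<Rightarrow> tm" where
  "std_ty 0 T = Star"
| "std_ty (Suc n) T =
     Arr (sub_tm (std_tm n (bdry n T)) (bdry_incl Minus n T))
         (std_ty n T)
         (sub_tm (std_tm n (bdry n T)) (bdry_incl Plus n T))"
| "std_tm n T =
     (if T = disc n then Var (2 * n)
      else Coh (tree_ctx T) (std_ty n T) (id_sub (tree_ctx T)))"

definition std_coh :: "nat \<Rightarrow> tree \<Rightarrow> tm" where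
  "std_coh n T = Coh (tree_ctx T) (std_ty n T) (id_sub (tree_ctx T))"

definition is_identity :: "tm \<Rightarrow> bool" where
  "is_identity t \<longleftrightarrow> (\<exists>n \<sigma>. length \<sigma> = length (tree_ctx (disc n)) \<and>
     t = sub_tm (std_coh (Suc n) (disc n)) \<sigma>)"

definition is_disc :: "tm \<Rightarrow> bool" where
  "is_disc t \<longleftrightarrow> (\<exists>n \<sigma>. length \<sigma> = length (tree_ctx (disc n)) \<and>
     t = sub_tm (std_coh n (disc n)) \<sigma>)"

definition is_std_composite :: "tm \<Rightarrow> bool" where
  "is_std_composite t \<longleftrightarrow> (\<exists>T \<tau>. length \<tau> = length (tree_ctx T) \<and>
     t = sub_tm (std_coh (tree_dim T) T) \<tau>)"


section \<open>Insertion\<close>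

text \<open>Positions in a tree are counted from 0.\<close>

fun is_path :: "tree \<Rightarrow> nat list \<Rightarrow> bool" where
  "is_path T [] \<longleftrightarrow> True"
| "is_path (Tree Ts) (k # P) \<longleftrightarrow> k < length Ts \<and> is_path (Ts ! k) P"

fun subtree :: "tree \<Rightarrow> nat list \<Rightarrow> tree" where
  "subtree T [] = T"
| "subtree (Tree Ts) (k # P) = subtree (Ts ! k) P"

definition is_branch :: "tree \<Rightarrow> nat list \<Rightarrow> bool" where
  "is_branch S P \<longleftrightarrow> P \<noteq> [] \<and> is_path S P \<and> linear (subtree S P)"

text \<open>\<open>child_var Ts k\<close> is the inclusion of the variables of the \<open>k\<close>-th child into \<open>tree_ctx (Tree Ts)\<close>.\<close>

fun child_var :: "tree list \<Rightarrow> nat \<Rightarrow> nat \<Rightarrow> nat" where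
  "child_var (T # Ts) 0 x = x + 2"
| "child_var (T # Ts) (Suc k) x = wedge_inr (susp_ctx (tree_ctx T)) (child_var Ts k x)"

text \<open>On the empty path, the tree is linear and its top-dimensional variable is the last one.\<close>

fun branch_var :: "tree \<Rightarrow> nat list \<Rightarrow> nat" where
  "branch_var T [] = 2 * tree_dim T"
| "branch_var (Tree Ts) (k # P) = child_var Ts k (branch_var (Ts ! k) P)"

definition branch_height :: "nat list \<Rightarrow> nat" where
  "branch_height P = length P - 1"

definition leaf_height :: "tree \<Rightarrow> nat list \<Rightarrow> nat" where
  "leaf_height S P = ty_dim (tree_ctx S ! branch_var S P)"

definition insertion_point :: "tree \<Rightarrow> nat list \<Rightarrow> tree \<Rightarrow> bool" where
  "insertion_point S P T \<longleftrightarrow>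
     is_branch S P \<and> branch_height P \<le> trunk_height T \<and> leaf_height S P \<ge> tree_dim T"

text \<open>
  In the recursive clauses below, \<^term>\<open>T\<close> has exactly one child whenever
  \<^prop>\<open>insertion_point S P T\<close> holds.
\<close>

fun insert_tree :: "tree \<Rightarrow> nat list \<Rightarrow> tree \<Rightarrow> tree" where
  "insert_tree (Tree Ss) [k] (Tree Ts) = Tree (take k Ss @ Ts @ drop (Suc k) Ss)"
| "insert_tree (Tree Ss) (k # k' # P) (Tree Ts) =
     Tree (take k Ss @ [insert_tree (Ss ! k) (k' # P) (hd Ts)] @ drop (Suc k) Ss)"

fun ext_sub :: "tree \<Rightarrow> nat list \<Rightarrow> tree \<Rightarrow> sub" where
  "ext_sub (Tree Ss) [k] T =
     (let l = leaf_height (Tree Ss) [k];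
          \<Gamma> = tree_ctx (Tree (take k Ss));
          \<Delta> = tree_ctx (Tree (drop (Suc k) Ss))
      in wedge_sub \<Gamma> (wedge (tree_ctx T) \<Delta>) (id_sub \<Gamma>)
           (wedge_sub (tree_ctx T) \<Delta> (disc_sub (std_ty l T) (std_coh l T)) (id_sub \<Delta>)))"
| "ext_sub (Tree Ss) (k # k' # P) (Tree Ts) =
     (let \<Theta> = susp_ctx (tree_ctx (insert_tree (Ss ! k) (k' # P) (hd Ts)));
          \<Gamma> = tree_ctx (Tree (take k Ss));
          \<Delta> = tree_ctx (Tree (drop (Suc k) Ss))
      in wedge_sub \<Gamma> (wedge \<Theta> \<Delta>) (id_sub \<Gamma>)
           (wedge_sub \<Theta> \<Delta> (susp_sub (ext_sub (Ss ! k) (k' # P) (hd Ts))) (id_sub \<Delta>)))"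

text \<open>\<open>Lab [t\<^sub>0, \<dots>, t\<^sub>n] [L\<^sub>1, \<dots>, L\<^sub>n]\<close> is the labelling \<open>t\<^sub>0 L\<^sub>1 t\<^sub>1 \<dots> L\<^sub>n t\<^sub>n\<close>.\<close>

datatype lab = Lab "tm list" "lab list"

inductive labelling :: "tree \<Rightarrow> lab \<Rightarrow> bool" where
  "length ts = Suc (length Ts) \<Longrightarrow> list_all2 labelling Ts Ls \<Longrightarrow> labelling (Tree Ts) (Lab ts Ls)"
monos list.rel_mono

text \<open>
  The variables of \<open>tree_ctx (Tree [T\<^sub>1, \<dots>, T\<^sub>n])\<close> are ordered as: the first point, the second point,
  the variables of \<open>T\<^sub>1\<close>, the third point, the variables of \<open>T\<^sub>2\<close>, and so on.
\<close>

primrec lab_sub :: "lab \<Rightarrow> sub" where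
  "lab_sub (Lab ts Ls) = hd ts # concat (map2 (#) (tl ts) (map lab_sub Ls))"

fun insert_lab :: "lab \<Rightarrow> nat list \<Rightarrow> lab \<Rightarrow> lab" where
  "insert_lab (Lab ss Ls) [k] (Lab ts Ms) =
     Lab (take k ss @ ts @ drop (k + 2) ss) (take k Ls @ Ms @ drop (Suc k) Ls)"
| "insert_lab (Lab ss Ls) (k # k' # P) (Lab ts Ms) =
     Lab (take k ss @ ts @ drop (k + 2) ss)
         (take k Ls @ [insert_lab (Ls ! k) (k' # P) (hd Ms)] @ drop (Suc k) Ls)"

text \<open>Here \<open>\<sigma>\<close> and \<open>\<tau>\<close> are given by their labellings \<open>L\<close> and \<open>M\<close>.\<close>

definition insertion_redex :: "tree \<Rightarrow> nat list \<Rightarrow> tree \<Rightarrow> lab \<Rightarrow> lab \<Rightarrow> bool" where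
  "insertion_redex S P T L M \<longleftrightarrow>
     insertion_point S P T \<and> labelling S L \<and> labelling T M \<and>
     sub_tm (Var (branch_var S P)) (lab_sub L) = sub_tm (std_coh (leaf_height S P) T) (lab_sub M)"


section \<open>The generating rules\<close>

inductive disc_removal :: "tm \<Rightarrow> tm \<Rightarrow> bool" where
  "n = ty_dim A \<Longrightarrow> disc_removal (sub_tm (std_coh n (disc n)) (disc_sub A u)) u"

inductive endo_removal :: "tm \<Rightarrow> tm \<Rightarrow> bool" where
  "n = ty_dim A \<Longrightarrow>
   endo_removal (Coh \<Delta> (Arr u A u) \<sigma>)
     (sub_tm (std_coh (Suc n) (disc n)) (disc_sub (sub_ty A \<sigma>) (sub_tm u \<sigma>)))"

text \<open>The first argument of \<open>insertion\<close> is the inserted argument \<open>\<lfloor>P\<rfloor>[\<sigma>]\<close> of the redex.\<close>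

inductive insertion :: "tm \<Rightarrow> tm \<Rightarrow> tm \<Rightarrow> bool" where
  "insertion_redex S P T L M \<Longrightarrow>
   insertion (sub_tm (Var (branch_var S P)) (lab_sub L))
     (Coh (tree_ctx S) A (lab_sub L))
     (Coh (tree_ctx (insert_tree S P T)) (sub_ty A (ext_sub S P T)) (lab_sub (insert_lab L P M)))"


section \<open>Typing and equality\<close>

inductive
      wf_ctx :: "ctx \<Rightarrow> bool"
  and wf_ty :: "ctx \<Rightarrow> ty \<Rightarrow> bool"
  and wf_tm :: "ctx \<Rightarrow> tm \<Rightarrow> ty \<Rightarrow> bool"
  and wf_sub :: "ctx \<Rightarrow> sub \<Rightarrow> ctx \<Rightarrow> bool"
  and eq_ty :: "ctx \<Rightarrow> ty \<Rightarrow> ty \<Rightarrow> bool"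
  and eq_tm :: "ctx \<Rightarrow> tm \<Rightarrow> tm \<Rightarrow> bool"
  and eq_sub :: "ctx \<Rightarrow> sub \<Rightarrow> sub \<Rightarrow> bool"
where
  ctx_empty: "wf_ctx []"
| ctx_ext: "wf_ctx \<Gamma> \<Longrightarrow> wf_ty \<Gamma> A \<Longrightarrow> wf_ctx (\<Gamma> @ [A])"

| ty_star: "wf_ty \<Gamma> Star"
| ty_arr: "wf_ty \<Gamma> A \<Longrightarrow> wf_tm \<Gamma> s A \<Longrightarrow> wf_tm \<Gamma> t A \<Longrightarrow> wf_ty \<Gamma> (Arr s A t)"

| sub_empty: "wf_sub \<Delta> [] []"
| sub_ext: "wf_sub \<Delta> \<sigma> \<Gamma> \<Longrightarrow> wf_ty \<Gamma> A \<Longrightarrow> wf_tm \<Delta> t (sub_ty A \<sigma>) \<Longrightarrow> wf_sub \<Delta> (\<sigma> @ [t]) (\<Gamma> @ [A])"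

| tm_var: "wf_ctx \<Gamma> \<Longrightarrow> i < length \<Gamma> \<Longrightarrow> wf_tm \<Gamma> (Var i) (\<Gamma> ! i)"
| tm_coh_comp: "\<Delta> = tree_ctx T \<Longrightarrow> wf_ty \<Delta> (Arr s A t) \<Longrightarrow> wf_sub \<Gamma> \<sigma> \<Delta> \<Longrightarrow> ctx_dim \<Delta> > 0 \<Longrightarrow>
    supp_tm \<Delta> s = supp_sub \<Delta> (bdry_incl Minus (ctx_dim \<Delta> - 1) T) \<Longrightarrow>
    supp_tm \<Delta> t = supp_sub \<Delta> (bdry_incl Plus (ctx_dim \<Delta> - 1) T) \<Longrightarrow>
    wf_tm \<Gamma> (Coh \<Delta> (Arr s A t) \<sigma>) (sub_ty (Arr s A t) \<sigma>)"
| tm_coh_full: "pasting \<Delta> \<Longrightarrow> wf_ty \<Delta> (Arr s A t) \<Longrightarrow> wf_sub \<Gamma> \<sigma> \<Delta> \<Longrightarrow>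
    supp_tm \<Delta> s = {..<length \<Delta>} \<Longrightarrow> supp_tm \<Delta> t = {..<length \<Delta>} \<Longrightarrow>
    wf_tm \<Gamma> (Coh \<Delta> (Arr s A t) \<sigma>) (sub_ty (Arr s A t) \<sigma>)"
| tm_conv: "wf_tm \<Gamma> s A \<Longrightarrow> eq_ty \<Gamma> A B \<Longrightarrow> wf_tm \<Gamma> s B"

| eq_ty_refl: "eq_ty \<Gamma> A A"
| eq_ty_sym: "eq_ty \<Gamma> A B \<Longrightarrow> eq_ty \<Gamma> B A"
| eq_ty_trans: "eq_ty \<Gamma> A B \<Longrightarrow> eq_ty \<Gamma> B C \<Longrightarrow> eq_ty \<Gamma> A C"
| eq_ty_arr: "eq_tm \<Gamma> s s' \<Longrightarrow> eq_ty \<Gamma> A A' \<Longrightarrow> eq_tm \<Gamma> t t' \<Longrightarrow> eq_ty \<Gamma> (Arr s A t) (Arr s' A' t')"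

| eq_tm_refl: "eq_tm \<Gamma> s s"
| eq_tm_sym: "eq_tm \<Gamma> s t \<Longrightarrow> eq_tm \<Gamma> t s"
| eq_tm_trans: "eq_tm \<Gamma> s t \<Longrightarrow> eq_tm \<Gamma> t u \<Longrightarrow> eq_tm \<Gamma> s u"
| eq_tm_coh: "eq_ty \<Delta> A B \<Longrightarrow> eq_sub \<Gamma> \<sigma> \<tau> \<Longrightarrow> eq_tm \<Gamma> (Coh \<Delta> A \<sigma>) (Coh \<Delta> B \<tau>)"
| eq_tm_disc: "wf_tm \<Gamma> s A \<Longrightarrow> disc_removal s t \<Longrightarrow> eq_tm \<Gamma> s t"
| eq_tm_endo: "wf_tm \<Gamma> s A \<Longrightarrow> endo_removal s t \<Longrightarrow> eq_tm \<Gamma> s t"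
| eq_tm_insert: "wf_tm \<Gamma> s A \<Longrightarrow> insertion a s t \<Longrightarrow> eq_tm \<Gamma> s t"

| eq_sub_refl: "eq_sub \<Gamma> \<sigma> \<sigma>"
| eq_sub_sym: "eq_sub \<Gamma> \<sigma> \<tau> \<Longrightarrow> eq_sub \<Gamma> \<tau> \<sigma>"
| eq_sub_trans: "eq_sub \<Gamma> \<sigma> \<tau> \<Longrightarrow> eq_sub \<Gamma> \<tau> \<rho> \<Longrightarrow> eq_sub \<Gamma> \<sigma> \<rho>"
| eq_sub_ext: "eq_sub \<Gamma> \<sigma> \<tau> \<Longrightarrow> eq_tm \<Gamma> s t \<Longrightarrow> eq_sub \<Gamma> (\<sigma> @ [s]) (\<tau> @ [t])"


section \<open>Reduction\<close>

text \<open>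
  No rule refers to the ambient context, so reduction is a relation on raw syntax; well-typedness is
  required of the term, type or substitution at which a reduction sequence starts.
\<close>

inductive
      red_ty :: "ty \<Rightarrow> ty \<Rightarrow> bool"
  and red_tm :: "tm \<Rightarrow> tm \<Rightarrow> bool"
  and red_sub :: "sub \<Rightarrow> sub \<Rightarrow> bool"
where
  red_disc: "disc_removal s t \<Longrightarrow> red_tm s t"
| red_endo: "endo_removal s t \<Longrightarrow> \<not> is_identity s \<Longrightarrow> red_tm s t"
| red_insert: "insertion a s t \<Longrightarrow> \<not> is_identity s \<Longrightarrow> \<not> is_disc s \<Longrightarrow>
    is_std_composite a \<or> is_identity a \<Longrightarrow> red_tm s t"
| red_coh_ty: "red_ty A B \<Longrightarrow> red_tm (Coh \<Delta> A \<sigma>) (Coh \<Delta> B \<sigma>)"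
| red_coh_sub: "red_sub \<sigma> \<tau> \<Longrightarrow> red_tm (Coh \<Delta> A \<sigma>) (Coh \<Delta> A \<tau>)"

| red_arr_src: "red_tm s s' \<Longrightarrow> red_ty (Arr s A t) (Arr s' A t)"
| red_arr_ty: "red_ty A A' \<Longrightarrow> red_ty (Arr s A t) (Arr s A' t)"
| red_arr_tgt: "red_tm t t' \<Longrightarrow> red_ty (Arr s A t) (Arr s A t')"

| red_sub_at: "red_tm t t' \<Longrightarrow> red_sub (\<sigma> @ t # \<tau>) (\<sigma> @ t' # \<tau>)"

end

theory Submission
  imports Defs "HOL-Library.Multiset_Order"
begin

text \<open>
  The complexity of a term is a multiset of dimensions: every coherence of dimension \<open>n\<close> outside the types
  of other coherences contributes \<open>n\<close> twice, or once if it is an identity. Removing a disc or inserting an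
  argument deletes a coherence without adding one; endo-coherence removal replaces a non-identity of
  dimension \<open>n + 1\<close> by an identity of the same dimension and copies only terms of dimension at most \<open>n\<close>.
  So each of these steps decreases the complexity, and only reduction inside the type of a coherence may
  fail to. As that type consists of terms of smaller dimension than the coherence, induction on the
  dimension gives termination.
\<close>

section \<open>Dimensions of the variables of a pasting context\<close>

text \<open>The type of a coherence has to stay outside the complexity: insertion turns
  \<open>A\<close> into \<open>sub_ty A (ext_sub S P T)\<close>, where a standard coherence takes
  the place of a variable, so a count that entered \<open>A\<close> could grow. Endo-coherence
  removal then brings the uncounted terms of such a type to the surface as arguments, possibly many
  times. Hence the multisets of dimensions instead of numbers, and the need to know that everything
  brought up has smaller dimension. This knowledge must survive reduction and must exclude
  coherences over a context of higher dimension than their type; for well-typed terms it comes from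
  the support conditions. Within one dimension the argument is lexicographic: the complexity first,
  then the steps inside types.\<close>

lemma ty_dim_sub_ty [simp]: "ty_dim (sub_ty A \<sigma>) = ty_dim A"
  by (induction A rule: ty.induct[where ?P2.0 = "\<lambda>_. True"]) auto

lemma ty_dim_susp_ty [simp]: "ty_dim (susp_ty A) = Suc (ty_dim A)"
  by (induction A rule: ty.induct[where ?P2.0 = "\<lambda>_. True"]) auto

text \<open>The dimensions of the variables of \<open>tree_ctx T\<close> in their order: for each
  child, its right end point precedes its own variables. Substitution preserves dimension, so the
  wedges disappear and recursion on the tree suffices.\<close>

primrec tree_dims :: "tree \<Rightarrow> nat list" where
  "tree_dims (Tree Ts) = 0 # concat (map (\<lambda>T. 0 # map Suc (tree_dims T)) Ts)"

lemma dims_wedge: "map ty_dim (wedge \<Gamma> \<Delta>) = map ty_dim \<Gamma> @ tl (map ty_dim \<Delta>)"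
  by (simp add: wedge_def map_tl comp_def)

lemma dims_susp_ctx: "map ty_dim (susp_ctx \<Gamma>) = 0 # 0 # map Suc (map ty_dim \<Gamma>)"
  by (simp add: susp_ctx_def)

lemma dims_tree_ctx [simp]: "map ty_dim (tree_ctx T) = tree_dims T"
  by (induction T rule: tree_ctx.induct) (simp_all add: dims_wedge dims_susp_ctx)

lemma length_tree_ctx [simp]: "length (tree_ctx T) = length (tree_dims T)"
  by (metis dims_tree_ctx length_map)

lemma set_tree_dims:
  "set (tree_dims (Tree Ts)) = insert 0 (\<Union>T \<in> set Ts. Suc ` set (tree_dims T))"
  by auto

lemma Suc_in_tree_dims:
  "Suc d \<in> set (tree_dims (Tree Ts)) \<longleftrightarrow> (\<exists>T \<in> set Ts. d \<in> set (tree_dims T))"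
  by (auto simp: set_tree_dims simp del: tree_dims.simps)

lemma tree_dims_bound: "d \<in> set (tree_dims T) \<Longrightarrow> d \<le> tree_dim T"
proof (induction T arbitrary: d)
  case (Tree Ts)
  show ?case
  proof (cases d)
    case (Suc e)
    with Tree.prems obtain T where T: "T \<in> set Ts" "e \<in> set (tree_dims T)"
      by (auto simp only: Suc_in_tree_dims)
    with Tree.IH have "e \<le> tree_dim T" by blast
    also have "\<dots> \<le> Max (set (map tree_dim Ts))" using T by simp
    finally show ?thesis using T Suc by auto
  qed simp
qed

lemma tree_dim_in_tree_dims: "tree_dim T \<in> set (tree_dims T)"
proof (induction T)
  case (Tree Ts)
  show ?case
  proof (cases "Ts = []")
    case False
    then have "Max (set (map tree_dim Ts)) \<in> set (map tree_dim Ts)"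
      by (intro Max_in) auto
    then obtain T where "T \<in> set Ts" "Max (set (map tree_dim Ts)) = tree_dim T" by auto
    then show ?thesis
      using Tree.IH False by (auto simp: Suc_in_tree_dims simp del: tree_dims.simps)
  qed simp
qed

lemma zero_in_tree_dims [simp]: "0 \<in> set (tree_dims T)"
  by (cases T) simp

text \<open>No dimension below the top is skipped; \<open>tree_dim_le_boundary\<close> finds its
  variable of codimension one in this way.\<close>

lemma tree_dims_down: "Suc d \<in> set (tree_dims T) \<Longrightarrow> d \<in> set (tree_dims T)"
proof (induction T arbitrary: d)
  case (Tree Ts)
  show ?case
  proof (cases d)
    case (Suc e)
    with Tree show ?thesis by (auto simp: Suc_in_tree_dims simp del: tree_dims.simps)
  qed simp
qed

lemma tree_dims_bdry_bound: "d \<in> set (tree_dims (bdry n T)) \<Longrightarrow> d \<le> n"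
proof (induction n T arbitrary: d rule: bdry.induct)
  case (2 n Ts)
  then show ?case by (cases d) (auto simp: Suc_in_tree_dims simp del: tree_dims.simps)
qed simp

lemma tree_dims_bdry: "d \<le> n \<Longrightarrow> d \<in> set (tree_dims T) \<Longrightarrow> d \<in> set (tree_dims (bdry n T))"
proof (induction n T arbitrary: d rule: bdry.induct)
  case (2 n Ts)
  show ?case
  proof (cases d)
    case (Suc e)
    with 2 show ?thesis by (auto simp: Suc_in_tree_dims simp del: tree_dims.simps)
  qed simp
qed simp

lemma ctx_dim_tree_ctx: "ctx_dim (tree_ctx T) = tree_dim T"
proof -
  have "foldr max xs 0 = Max (set xs)" if "xs \<noteq> []" for xs :: "nat list"
    using that by (induction xs rule: list_nonempty_induct) simp_all
  moreover have "tree_dims T \<noteq> []" by (cases T) simp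
  moreover have "Max (set (tree_dims T)) = tree_dim T"
    using tree_dims_bound tree_dim_in_tree_dims by (intro Max_eqI) auto
  ultimately show ?thesis by (simp add: ctx_dim_def)
qed

lemma ty_dim_in_tree_dims: "A \<in> set (tree_ctx T) \<Longrightarrow> ty_dim A \<in> set (tree_dims T)"
  by (simp flip: dims_tree_ctx)

lemma nth_tree_dims: "i < length (tree_dims T) \<Longrightarrow> tree_dims T ! i = ty_dim (tree_ctx T ! i)"
  by (metis dims_tree_ctx length_map nth_map)

lemma tree_dims_disc: "tree_dims (disc n) = concat (map (\<lambda>i. [i, i]) [0..<n]) @ [n]"
proof (induction n)
  case (Suc n)
  have "map Suc (concat (map (\<lambda>i. [i, i]) [0..<n])) = concat (map (\<lambda>i. [i, i]) [Suc 0..<Suc n])"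
    by (simp only: map_Suc_upt[symmetric] map_concat map_map comp_def list.map)
  with Suc show ?case by (simp add: upt_conv_Cons del: upt_Suc)
qed simp

lemma length_tree_dims_disc [simp]: "length (tree_dims (disc n)) = Suc (2 * n)"
  by (induction n) simp_all

lemma tree_dims_disc_top [simp]: "tree_dims (disc n) ! (2 * n) = n"
  by (induction n) simp_all

lemma tree_dim_disc [simp]: "tree_dim (disc n) = n"
  by (induction n) simp_all

lemma bdry_disc: "k \<le> n \<Longrightarrow> bdry k (disc n) = disc k"
proof (induction n arbitrary: k)
  case (Suc n)
  then show ?case by (cases k) simp_all
qed simp

lemma linear_disc: "linear T \<Longrightarrow> T = disc (tree_dim T)"
  unfolding linear_def by (induction T rule: trunk_height.induct) simp_all

section \<open>Dimension-typed terms\<close>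

text \<open>
  Subject reduction for the typing rules is avoided: the termination argument only needs the following
  weak typing discipline on dimensions, in which a context is reduced to the list \<open>ds\<close> of the dimensions
  of its variables, and \<open>wd_tm ds n t\<close> bounds the dimension of \<open>t\<close> by \<open>n\<close>. The essential clause is that in
  \<open>coh(\<Delta> : A)[\<sigma>]\<close> the dimension of \<open>\<Delta>\<close> is at most that of \<open>A\<close>.
\<close>

inductive wd_ty :: "nat list \<Rightarrow> ty \<Rightarrow> bool" and wd_tm :: "nat list \<Rightarrow> nat \<Rightarrow> tm \<Rightarrow> bool" where
  wd_Star: "wd_ty ds Star"
| wd_Arr: "wd_tm ds (ty_dim A) s \<Longrightarrow> wd_ty ds A \<Longrightarrow> wd_tm ds (ty_dim A) t \<Longrightarrow> wd_ty ds (Arr s A t)"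
| wd_Var: "i < length ds \<Longrightarrow> ds ! i \<le> n \<Longrightarrow> wd_tm ds n (Var i)"
| wd_Coh: "ty_dim A \<le> n \<Longrightarrow> \<forall>d \<in> set (map ty_dim \<Delta>). d \<le> ty_dim A \<Longrightarrow> wd_ty (map ty_dim \<Delta>) A \<Longrightarrow>
    list_all2 (wd_tm ds) (map ty_dim \<Delta>) \<sigma> \<Longrightarrow> wd_tm ds n (Coh \<Delta> A \<sigma>)"
  monos list.rel_mono

inductive_simps wd_simps [simp]:
  "wd_ty ds Star" "wd_ty ds (Arr s A t)" "wd_tm ds n (Var i)" "wd_tm ds n (Coh \<Delta> A \<sigma>)"

lemma wd_tm_mono: "wd_tm ds n t \<Longrightarrow> n \<le> m \<Longrightarrow> wd_tm ds m t"
  by (cases t) auto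

lemma
  shows wd_ty_sub: "wd_ty ds A \<Longrightarrow> list_all2 (wd_tm es) ds \<sigma> \<Longrightarrow> wd_ty es (sub_ty A \<sigma>)"
    and wd_tm_sub: "wd_tm ds n t \<Longrightarrow> list_all2 (wd_tm es) ds \<sigma> \<Longrightarrow> wd_tm es n (sub_tm t \<sigma>)"
proof (induction rule: wd_ty_wd_tm.inducts)
  case (wd_Var i ds n)
  then have "wd_tm es (ds ! i) (\<sigma> ! i)" by (simp add: list_all2_conv_all_nth)
  then show ?case using wd_Var.hyps(2) by (simp add: wd_tm_mono)
next
  case (wd_Coh A n \<Delta> ds \<tau>)
  then show ?case by (auto simp: list_all2_conv_all_nth)
qed auto

lemma
  shows wd_ty_susp: "wd_ty ds A \<Longrightarrow> wd_ty (0 # 0 # map Suc ds) (susp_ty A)"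
    and wd_tm_susp: "wd_tm ds n t \<Longrightarrow> wd_tm (0 # 0 # map Suc ds) (Suc n) (susp_tm t)"
proof (induction rule: wd_ty_wd_tm.inducts)
  case (wd_Coh A n \<Delta> ds \<tau>)
  then show ?case by (auto simp: list_all2_conv_all_nth comp_def nth_Cons')
qed (auto simp: nth_Cons')

lemma
  shows wd_ty_append: "wd_ty ds A \<Longrightarrow> wd_ty (ds @ es) A"
    and wd_tm_append: "wd_tm ds n t \<Longrightarrow> wd_tm (ds @ es) n t"
proof (induction rule: wd_ty_wd_tm.inducts)
  case (wd_Coh A n \<Delta> ds \<tau>)
  then show ?case by (auto elim: list_all2_mono)
qed (auto simp: nth_append)

text \<open>An argument of a coherence fills a variable of \<open>\<Delta>\<close>, whose dimension
  is at most that of \<open>A\<close>, so no free variable exceeds the bound. For types the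
  inequality is strict because the end terms of an arrow live one dimension below it.\<close>

lemma
  shows wd_ty_fv: "wd_ty ds A \<Longrightarrow> x \<in> fv_ty A \<Longrightarrow> x < length ds \<and> ds ! x < ty_dim A"
    and wd_tm_fv: "wd_tm ds n t \<Longrightarrow> x \<in> fv_tm t \<Longrightarrow> x < length ds \<and> ds ! x \<le> n"
proof (induction rule: wd_ty_wd_tm.inducts)
  case (wd_Coh A n \<Delta> ds \<tau>)
  from wd_Coh.IH(2) have len: "length \<tau> = length \<Delta>" by (simp add: list_all2_conv_all_nth)
  with wd_Coh.prems obtain i where i: "i < length \<Delta>" "x \<in> fv_tm (\<tau> ! i)"
    by (auto simp: in_set_conv_nth)
  have "x < length ds \<and> ds ! x \<le> ty_dim (\<Delta> ! i)"
    using list_all2_nthD2[OF wd_Coh.IH(2), of i] i len by simp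
  moreover have "ty_dim (\<Delta> ! i) \<le> ty_dim A" using wd_Coh.hyps(2) i(1) by simp
  ultimately show ?case using wd_Coh.hyps(1) by linarith
qed auto

section \<open>Suspensions and wedges of substitutions, boundary inclusions\<close>

definition var_of :: "nat list \<Rightarrow> nat \<Rightarrow> tm \<Rightarrow> bool" where
  "var_of ds d t \<longleftrightarrow> (\<exists>i < length ds. t = Var i \<and> ds ! i = d)"

lemma var_of_wd: "var_of ds d t \<Longrightarrow> wd_tm ds d t"
  by (auto simp: var_of_def)

lemma vars_of_wd: "list_all2 (var_of ds) es \<sigma> \<Longrightarrow> list_all2 (wd_tm ds) es \<sigma>"
  by (erule list_all2_mono) (rule var_of_wd)

lemma var_of_sub: "var_of ds d t \<Longrightarrow> list_all2 (var_of es) ds \<sigma> \<Longrightarrow> var_of es d (sub_tm t \<sigma>)"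
  by (auto simp: var_of_def list_all2_conv_all_nth)

lemma var_of_append:
  assumes "var_of ds d t"
  shows "var_of (ds @ es) d t"
proof -
  from assms obtain i where "i < length ds" "t = Var i" "ds ! i = d" by (auto simp: var_of_def)
  then have "i < length (ds @ es) \<and> t = Var i \<and> (ds @ es) ! i = d" by (simp add: nth_append)
  then show ?thesis unfolding var_of_def by blast
qed

lemma vars_of_id_sub: "list_all2 (var_of (map ty_dim \<Gamma>)) (map ty_dim \<Gamma>) (id_sub \<Gamma>)"
  by (auto simp: list_all2_conv_all_nth id_sub_def var_of_def)

lemma vars_of_susp_sub:
  "list_all2 (var_of ds) es \<sigma> \<Longrightarrow>
    list_all2 (var_of (0 # 0 # map Suc ds)) (0 # 0 # map Suc es) (susp_sub \<sigma>)"
  unfolding susp_sub_def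
  by (auto simp: list_all2_map1 list_all2_map2 var_of_def elim!: list_all2_mono)

lemma wd_susp_sub:
  "list_all2 (wd_tm ds) es \<sigma> \<Longrightarrow>
    list_all2 (wd_tm (0 # 0 # map Suc ds)) (0 # 0 # map Suc es) (susp_sub \<sigma>)"
  unfolding susp_sub_def
  by (auto simp: list_all2_map1 list_all2_map2 wd_tm_susp elim!: list_all2_mono)

text \<open>Ensures that \<open>last_pt\<close> takes \<open>last\<close> of a non-empty list and
  that gluing at the first variable happens at a point.\<close>

definition pointed :: "ctx \<Rightarrow> bool" where
  "pointed \<Gamma> \<longleftrightarrow> \<Gamma> \<noteq> [] \<and> \<Gamma> ! 0 = Star"

lemma pointed_susp_ctx [simp]: "pointed (susp_ctx \<Gamma>)"
  by (simp add: pointed_def susp_ctx_def)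

lemma pointed_wedge [simp]: "pointed \<Gamma> \<Longrightarrow> pointed (wedge \<Gamma> \<Delta>)"
  by (auto simp: pointed_def wedge_def nth_append)

lemma pointed_tree_ctx [simp]: "pointed (tree_ctx T)"
  by (induction T rule: tree_ctx.induct) (simp_all add: pointed_def[of "[Star]"])

lemma last_pt: "pointed \<Gamma> \<Longrightarrow> last_pt \<Gamma> < length \<Gamma> \<and> \<Gamma> ! last_pt \<Gamma> = Star"
proof -
  assume "pointed \<Gamma>"
  then have "0 \<in> set (filter (\<lambda>i. \<Gamma> ! i = Star) [0..<length \<Gamma>])"
    by (auto simp: pointed_def)
  then have "last_pt \<Gamma> \<in> set (filter (\<lambda>i. \<Gamma> ! i = Star) [0..<length \<Gamma>])"
    unfolding last_pt_def by (metis last_in_set empty_iff empty_set)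
  then show ?thesis by simp
qed

lemma vars_of_wedge_inr_sub:
  assumes "pointed \<Gamma>" "pointed \<Delta>"
  shows "list_all2 (var_of (map ty_dim (wedge \<Gamma> \<Delta>))) (map ty_dim \<Delta>) (wedge_inr_sub \<Gamma> \<Delta>)"
proof -
  have "var_of (map ty_dim (wedge \<Gamma> \<Delta>)) (ty_dim (\<Delta> ! j)) (Var (wedge_inr \<Gamma> j))"
    if "j < length \<Delta>" for j
  proof (cases j)
    case 0
    then show ?thesis using last_pt[OF assms(1)] assms(2)
      by (simp add: var_of_def dims_wedge wedge_inr_def nth_append pointed_def)
  next
    case (Suc i)
    then show ?thesis using that by (simp add: var_of_def dims_wedge wedge_inr_def nth_append nth_tl)
  qed
  then show ?thesis by (simp add: wedge_inr_sub_def list_all2_conv_all_nth)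
qed

lemma list_all2_tl: "list_all2 P xs ys \<Longrightarrow> list_all2 P (tl xs) (tl ys)"
  by (cases xs; cases ys) auto

lemma vars_of_wedge_sub:
  assumes "list_all2 (var_of (map ty_dim \<Gamma>)) ds \<sigma>" "list_all2 (var_of (map ty_dim \<Delta>)) es \<tau>"
    and "pointed \<Gamma>" "pointed \<Delta>"
  shows "list_all2 (var_of (map ty_dim (wedge \<Gamma> \<Delta>))) (ds @ tl es) (wedge_sub \<Gamma> \<Delta> \<sigma> \<tau>)"
proof -
  have "list_all2 (var_of (map ty_dim (wedge \<Gamma> \<Delta>))) ds \<sigma>"
    unfolding dims_wedge using assms(1) by (rule list_all2_mono) (rule var_of_append)
  moreover have "list_all2 (var_of (map ty_dim (wedge \<Gamma> \<Delta>))) (tl es)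
      (map (\<lambda>t. sub_tm t (wedge_inr_sub \<Gamma> \<Delta>)) (tl \<tau>))"
    unfolding list_all2_map2 using list_all2_tl[OF assms(2)]
    by (rule list_all2_mono) (rule var_of_sub[OF _ vars_of_wedge_inr_sub[OF assms(3,4)]])
  ultimately show ?thesis unfolding wedge_sub_def by (rule list_all2_appendI)
qed

lemma wd_wedge_sub:
  assumes "list_all2 (wd_tm (map ty_dim \<Gamma>)) ds \<sigma>" "list_all2 (wd_tm (map ty_dim \<Delta>)) es \<tau>"
    and "pointed \<Gamma>" "pointed \<Delta>"
  shows "list_all2 (wd_tm (map ty_dim (wedge \<Gamma> \<Delta>))) (ds @ tl es) (wedge_sub \<Gamma> \<Delta> \<sigma> \<tau>)"
proof -
  have "list_all2 (wd_tm (map ty_dim (wedge \<Gamma> \<Delta>))) ds \<sigma>"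
    unfolding dims_wedge using assms(1) by (rule list_all2_mono) (rule wd_tm_append)
  moreover have "list_all2 (wd_tm (map ty_dim (wedge \<Gamma> \<Delta>))) (tl es)
      (map (\<lambda>t. sub_tm t (wedge_inr_sub \<Gamma> \<Delta>)) (tl \<tau>))"
    unfolding list_all2_map2 using list_all2_tl[OF assms(2)]
    by (rule list_all2_mono)
      (rule wd_tm_sub[OF _ vars_of_wd[OF vars_of_wedge_inr_sub[OF assms(3,4)]]])
  ultimately show ?thesis unfolding wedge_sub_def by (rule list_all2_appendI)
qed

text \<open>The exact form, variables of equal dimension, matters twice later: the support of a
  boundary reaches the top dimension of that boundary, and the standard types of discs consist of
  variables.\<close>

lemma vars_of_bdry_incl:
  "list_all2 (var_of (tree_dims T)) (tree_dims (bdry n T)) (bdry_incl \<epsilon> n T)"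
proof (induction \<epsilon> n T rule: bdry_incl.induct)
  case (1 T)
  then show ?case by (cases T) (simp add: var_of_def)
next
  case (2 T)
  have "last_pt (tree_ctx T) < length (tree_dims T)" "tree_dims T ! last_pt (tree_ctx T) = 0"
    using last_pt[of "tree_ctx T"] nth_tree_dims[of "last_pt (tree_ctx T)" T] by simp_all
  then show ?case by (simp add: var_of_def)
next
  case (3 \<epsilon> n)
  then show ?case by (simp add: var_of_def)
next
  case (4 \<epsilon> n T Ts)
  have "list_all2 (var_of (map ty_dim (susp_ctx (tree_ctx T))))
      (0 # 0 # map Suc (tree_dims (bdry n T))) (susp_sub (bdry_incl \<epsilon> n T))"
    unfolding dims_susp_ctx dims_tree_ctx by (rule vars_of_susp_sub[OF "4.IH"(1)])
  moreover have "list_all2 (var_of (map ty_dim (tree_ctx (Tree Ts))))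
      (tree_dims (bdry (Suc n) (Tree Ts))) (bdry_incl \<epsilon> (Suc n) (Tree Ts))"
    unfolding dims_tree_ctx by (rule "4.IH"(2))
  ultimately have "list_all2 (var_of (map ty_dim (tree_ctx (Tree (T # Ts)))))
      ((0 # 0 # map Suc (tree_dims (bdry n T))) @ tl (tree_dims (bdry (Suc n) (Tree Ts))))
      (bdry_incl \<epsilon> (Suc n) (Tree (T # Ts)))"
    unfolding tree_ctx.simps bdry_incl.simps
    by (rule vars_of_wedge_sub[OF _ _ pointed_susp_ctx pointed_tree_ctx])
  then show ?case unfolding dims_tree_ctx by simp
qed

section \<open>Standard types, standard coherences and disc substitutions\<close>

lemma ty_dim_std_ty [simp]: "ty_dim (std_ty n T) = n"
  by (induction n) simp_all

lemma wd_id_sub: "list_all2 (wd_tm (tree_dims T)) (tree_dims T) (id_sub (tree_ctx T))"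
  using vars_of_wd[OF vars_of_id_sub[of "tree_ctx T"]] by simp

text \<open>Holds for every \<open>n\<close>, even below \<open>tree_dim T\<close>: the coherences
  in the type live over \<open>bdry n T\<close>, which is cut off at dimension \<open>n\<close>, so
  the dimension clause of \<open>wd_Coh\<close> is met.\<close>

lemma wd_std_ty: "wd_ty (tree_dims T) (std_ty n T)"
proof (induction n arbitrary: T)
  case (Suc n)
  have "wd_tm (tree_dims (bdry n T)) n (std_tm n (bdry n T))"
  proof (cases "bdry n T = disc n")
    case True
    then show ?thesis by (simp only: std_tm.simps if_True) simp
  next
    case False
    have "\<forall>A \<in> set (tree_ctx (bdry n T)). ty_dim A \<le> n"
      using tree_dims_bdry_bound ty_dim_in_tree_dims by blast
    with False show ?thesis by (subst std_tm.simps) (simp add: Suc wd_id_sub)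
  qed
  then have "wd_tm (tree_dims T) n (sub_tm (std_tm n (bdry n T)) (bdry_incl \<epsilon> n T))" for \<epsilon>
    by (rule wd_tm_sub[OF _ vars_of_wd[OF vars_of_bdry_incl]])
  then show ?case unfolding std_ty.simps wd_simps ty_dim_std_ty using Suc by blast
qed simp

lemma wd_std_coh: "tree_dim T \<le> n \<Longrightarrow> wd_tm (tree_dims T) n (std_coh n T)"
proof -
  assume "tree_dim T \<le> n"
  then have "\<forall>A \<in> set (tree_ctx T). ty_dim A \<le> n"
    using tree_dims_bound[OF ty_dim_in_tree_dims] order_trans by blast
  then show ?thesis by (simp add: std_coh_def wd_std_ty wd_id_sub)
qed

lemma length_ty_spheres [simp]: "length (ty_spheres A) = 2 * ty_dim A"
  by (induction A rule: ty.induct[where ?P2.0 = "\<lambda>_. True"]) auto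

lemma length_disc_sub [simp]: "length (disc_sub A t) = Suc (2 * ty_dim A)"
  by (simp add: disc_sub_def)

lemma wd_ty_spheres:
  "wd_ty ds A \<Longrightarrow> list_all2 (wd_tm ds) (concat (map (\<lambda>i. [i, i]) [0..<ty_dim A])) (ty_spheres A)"
  by (induction A rule: ty.induct[where ?P2.0 = "\<lambda>_. True"]) (auto intro: list_all2_appendI)

lemma wd_disc_sub:
  assumes "wd_ty ds A" "wd_tm ds (ty_dim A) t"
  shows "list_all2 (wd_tm ds) (tree_dims (disc (ty_dim A))) (disc_sub A t)"
  unfolding disc_sub_def tree_dims_disc
  using assms by (intro list_all2_appendI wd_ty_spheres) auto

text \<open>Composing \<open>id_sub\<close> with the bare list \<open>\<sigma>\<close> gives back
  \<open>\<sigma>\<close> only if the lengths agree.\<close>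

lemma std_coh_sub:
  assumes "length \<sigma> = length (tree_dims T)"
  shows "sub_tm (std_coh n T) \<sigma> = Coh (tree_ctx T) (std_ty n T) \<sigma>"
  using assms map_nth[of \<sigma>] by (simp add: std_coh_def id_sub_def comp_def)

section \<open>Labellings and insertion\<close>

text \<open>\<open>Q\<close> receives the depth of a label, which is its dimension, so it is shifted
  by \<open>Suc\<close> on entering a child. It is the last argument so that the recursive calls
  \<open>map lab_all Ls\<close> are still functions of the predicate.\<close>

primrec lab_all :: "lab \<Rightarrow> (nat \<Rightarrow> tm \<Rightarrow> bool) \<Rightarrow> bool" where
  "lab_all (Lab ts Ls) Q \<longleftrightarrow>
     list_all (Q 0) ts \<and> list_all (\<lambda>f. f (\<lambda>d. Q (Suc d))) (map lab_all Ls)"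

primrec lab_sum :: "(tm \<Rightarrow> 'b::comm_monoid_add) \<Rightarrow> lab \<Rightarrow> 'b" where
  "lab_sum f (Lab ts Ls) = sum_list (map f ts) + sum_list (map (lab_sum f) Ls)"

inductive_simps labelling_simps [simp]: "labelling (Tree Ts) (Lab ts Ls)"

lemma length_lab_sub: "labelling T L \<Longrightarrow> length (lab_sub L) = length (tree_dims T)"
proof (induction rule: labelling.induct)
  case (1 ts Ts Ls)
  then obtain t us where ts: "ts = t # us" "length us = length Ts" by (cases ts) auto
  from 1(2) ts(2)
  have "length (concat (map2 (#) us (map lab_sub Ls))) =
      length (concat (map (\<lambda>T. 0 # map Suc (tree_dims T)) Ts))"
  proof (induction arbitrary: us rule: list_all2_induct)
    case (Cons T Ts L Ls)
    then show ?case by (cases us) auto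
  qed simp
  then show ?case using ts by simp
qed

text \<open>Insertion acts on labellings, whereas reduction and dimensions concern flat lists. This
  lemma and \<open>lab_sub_sum\<close> translate between the two.\<close>

lemma lab_sub_all: "labelling T L \<Longrightarrow> list_all2 Q (tree_dims T) (lab_sub L) \<longleftrightarrow> lab_all L Q"
proof (induction arbitrary: Q rule: labelling.induct)
  case (1 ts Ts Ls)
  then obtain t us where ts: "ts = t # us" "length us = length Ts" by (cases ts) auto
  from 1(2) ts(2)
  have "list_all2 Q (concat (map (\<lambda>T. 0 # map Suc (tree_dims T)) Ts))
      (concat (map2 (#) us (map lab_sub Ls))) \<longleftrightarrow>
      list_all (Q 0) us \<and> list_all (\<lambda>L. lab_all L (\<lambda>d. Q (Suc d))) Ls"
  proof (induction arbitrary: us rule: list_all2_induct)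
    case (Cons T Ts L Ls)
    from Cons.prems obtain u vs where us: "us = u # vs" "length vs = length Ts" by (cases us) auto
    from Cons(1) have "list_all2 Q (map Suc (tree_dims T)) (lab_sub L) \<longleftrightarrow> lab_all L (\<lambda>d. Q (Suc d))"
      by (simp add: list_all2_map1)
    moreover have "length (map Suc (tree_dims T)) = length (lab_sub L)"
      using Cons(1) by (metis length_lab_sub length_map)
    ultimately show ?case
      using Cons.IH[OF us(2)] by (simp add: us list_all2_append conj_ac del: list_all2_map1)
  qed simp
  then show ?case using ts by (simp add: list_all_iff)
qed

lemma lab_sub_sum: "labelling T L \<Longrightarrow> sum_list (map f (lab_sub L)) = lab_sum f L"
proof (induction rule: labelling.induct)
  case (1 ts Ts Ls)
  then obtain t us where ts: "ts = t # us" "length us = length Ts" by (cases ts) auto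
  from 1(2) ts(2)
  have "sum_list (map f (concat (map2 (#) us (map lab_sub Ls)))) =
      sum_list (map f us) + sum_list (map (lab_sum f) Ls)"
  proof (induction arbitrary: us rule: list_all2_induct)
    case (Cons T Ts L Ls)
    from Cons.prems obtain u vs where us: "us = u # vs" "length vs = length Ts" by (cases us) auto
    show ?case using Cons(1) Cons.IH[OF us(2)] by (simp add: us ac_simps)
  qed simp
  then show ?case using ts by (simp add: ac_simps)
qed

text \<open>Both \<open>tree_dims\<close> and \<open>lab_sub\<close> have the shape
  \<open>h # concat (map2 (#) us bs)\<close> with one block per child, so one index computation
  serves both. Positivity of the index is carried through the induction because
  \<open>wedge_inr\<close> treats 0, the glued point, separately.\<close>

lemma child_var_nth:
  assumes "list_all2 (\<lambda>T b. length b = length (tree_dims T)) Ts bs" "length us = length Ts"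
    and "k < length Ts" "x < length (tree_dims (Ts ! k))"
  shows "0 < child_var Ts k x \<and> child_var Ts k x < Suc (length (concat (map2 (#) us bs))) \<and>
    (h # concat (map2 (#) us bs)) ! child_var Ts k x = bs ! k ! x"
  using assms
proof (induction arbitrary: us k h rule: list_all2_induct)
  case (Cons T Ts b bs)
  from Cons.prems obtain u vs where us: "us = u # vs" "length vs = length Ts" by (cases us) auto
  show ?case
  proof (cases k)
    case 0
    then show ?thesis using Cons by (simp add: us nth_append)
  next
    case (Suc j)
    let ?c = "child_var Ts j x"
    have IH: "0 < ?c" "?c < Suc (length (concat (map2 (#) vs bs)))"
      "(u # concat (map2 (#) vs bs)) ! ?c = bs ! j ! x"
      using Cons.IH[OF us(2), of j] Cons.prems Suc by auto
    then obtain c where c: "?c = Suc c" by (cases ?c) auto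
    have "child_var (T # Ts) k x = length (susp_ctx (tree_ctx T)) + c"
      using Suc c by (simp add: wedge_inr_def)
    moreover have "length (susp_ctx (tree_ctx T)) = Suc (Suc (length b))"
      using Cons by (simp add: susp_ctx_def)
    ultimately show ?thesis using IH c Suc by (simp add: us nth_append)
  qed
qed simp

lemma tree_dims_child_var:
  assumes "k < length Ts" "x < length (tree_dims (Ts ! k))"
  shows "child_var Ts k x < length (tree_dims (Tree Ts)) \<and>
    tree_dims (Tree Ts) ! child_var Ts k x = Suc (tree_dims (Ts ! k) ! x)"
proof -
  have "map (\<lambda>T. 0 # map Suc (tree_dims T)) Ts =
      map2 (#) (replicate (length Ts) 0) (map (\<lambda>T. map Suc (tree_dims T)) Ts)"
    by (induction Ts) simp_all
  then show ?thesis
    using child_var_nth[of Ts "map (\<lambda>T. map Suc (tree_dims T)) Ts" "replicate (length Ts) 0" k x 0]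
      assms
    by (simp add: list_all2_conv_all_nth)
qed

lemma lab_sub_child_var:
  assumes "labelling (Tree Ts) (Lab ts Ls)" "k < length Ts" "x < length (tree_dims (Ts ! k))"
  shows "lab_sub (Lab ts Ls) ! child_var Ts k x = lab_sub (Ls ! k) ! x"
proof -
  have "list_all2 (\<lambda>T b. length b = length (tree_dims T)) Ts (map lab_sub Ls)"
    using assms(1) by (auto simp: list_all2_conv_all_nth length_lab_sub)
  then show ?thesis
    using child_var_nth[of Ts "map lab_sub Ls" "tl ts" k x "hd ts"] assms
    by (auto dest: list_all2_lengthD)
qed

text \<open>Stated for paths instead of branches so that the induction can start at the empty path,
  where the linear tree is a disc. Each step along the path is a suspension and adds one.\<close>

lemma branch_var_dim:
  assumes "is_path S P" "linear (subtree S P)"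
  shows "branch_var S P < length (tree_dims S) \<and>
    tree_dims S ! branch_var S P = length P + tree_dim (subtree S P)"
  using assms
proof (induction S P rule: is_path.induct)
  case (1 T)
  then have "T = disc (tree_dim T)" using linear_disc by simp
  then show ?case by simp (metis length_tree_dims_disc lessI tree_dims_disc_top)
next
  case (2 Ts k P)
  then show ?case using tree_dims_child_var[of k Ts "branch_var (Ts ! k) P"] by simp
qed

lemma leaf_height_eq:
  assumes "is_path S P" "linear (subtree S P)"
  shows "leaf_height S P = length P + tree_dim (subtree S P)"
  unfolding leaf_height_def
  using branch_var_dim[OF assms] nth_tree_dims[of "branch_var S P" S] by simp

lemma trunk_height_SucE:
  assumes "Suc n \<le> trunk_height (Tree Ts)"
  obtains T where "Ts = [T]" "n \<le> trunk_height T"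
  using assms by (cases "Tree Ts" rule: trunk_height.cases) auto

section \<open>The effect of insertion on labellings\<close>

lemma sum_list_split:
  fixes f :: "'a \<Rightarrow> 'b::comm_monoid_add"
  assumes "k < length xs"
  shows "sum_list (map f xs) =
    sum_list (map f (take k xs)) + (f (xs ! k) + sum_list (map f (drop (Suc k) xs)))"
  using arg_cong[OF id_take_nth_drop[OF assms], of "\<lambda>ys. sum_list (map f ys)"] by simp

lemma sum_list_split2:
  fixes f :: "'a \<Rightarrow> 'b::comm_monoid_add"
  assumes "Suc k < length xs"
  shows "sum_list (map f xs) = sum_list (map f (take k xs)) +
    (f (xs ! k) + (f (xs ! Suc k) + sum_list (map f (drop (Suc (Suc k)) xs))))"
proof -
  have "drop (Suc k) xs = xs ! Suc k # drop (Suc (Suc k)) xs"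
    using assms by (simp add: Cons_nth_drop_Suc)
  then show ?thesis using assms sum_list_split[of k xs f] by simp
qed

text \<open>The last conjunct is an inclusion because insertion discards more than the argument at
  the branch: also the other labels of the linear subtree, and the points of \<open>L\<close> that
  those of \<open>M\<close> overwrite. \<open>Q\<close> varies in the induction, since entering a
  child shifts dimensions.\<close>

lemma insert_lab:
  assumes "is_path S P" "linear (subtree S P)" "P \<noteq> []" "branch_height P \<le> trunk_height T"
    and "labelling S L" "labelling T M"
  shows "labelling (insert_tree S P T) (insert_lab L P M) \<and>
    (lab_all L Q \<longrightarrow> lab_all M Q \<longrightarrow> lab_all (insert_lab L P M) Q) \<and>
    lab_sum f (insert_lab L P M) + f (lab_sub L ! branch_var S P) \<subseteq># lab_sum f L + lab_sum f M"
  using assms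
proof (induction S P T arbitrary: L M Q rule: insert_tree.induct)
  case (1 Ss k Ts)
  obtain ss Ls where L: "L = Lab ss Ls" by (cases L)
  obtain ts Ms where M: "M = Lab ts Ms" by (cases M)
  from 1 L have k: "k < length Ss" "length ss = Suc (length Ss)" "list_all2 labelling Ss Ls"
    by auto
  then have len: "length Ls = length Ss" by (auto dest: list_all2_lengthD)
  from 1 M have Ms: "length ts = Suc (length Ts)" "list_all2 labelling Ts Ms" by auto
  have "labelling (insert_tree (Tree Ss) [k] (Tree Ts)) (insert_lab L [k] M)"
    using k len Ms unfolding L M
    by (auto intro!: list_all2_appendI list_all2_takeI list_all2_dropI)
  moreover have "lab_all (insert_lab L [k] M) Q" if "lab_all L Q" "lab_all M Q"
    using that unfolding L M by (auto simp: list_all_iff dest: in_set_takeD in_set_dropD)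
  moreover have "lab_sum f (insert_lab L [k] M) + f (lab_sub L ! branch_var (Tree Ss) [k])
      \<subseteq># lab_sum f L + lab_sum f M"
  proof -
    let ?x = "2 * tree_dim (Ss ! k)"
    from 1(1,2) have x: "?x < length (tree_dims (Ss ! k))"
      using branch_var_dim[of "Ss ! k" "[]"] by simp
    have lk: "labelling (Ss ! k) (Ls ! k)" using k by (auto simp: list_all2_conv_all_nth)
    have "lab_sub L ! branch_var (Tree Ss) [k] = lab_sub (Ls ! k) ! ?x"
      using lab_sub_child_var[of Ss ss Ls k ?x] 1(5) k x by (simp add: L del: lab_sub.simps)
    also have "f \<dots> \<in> set (map f (lab_sub (Ls ! k)))"
      using x lk by (simp add: length_lab_sub)
    then have "f (lab_sub (Ls ! k) ! ?x) \<subseteq># lab_sum f (Ls ! k)"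
      unfolding lab_sub_sum[OF lk, symmetric]
      by (auto simp del: set_map dest!: split_list)
    finally have a: "f (lab_sub L ! branch_var (Tree Ss) [k]) \<subseteq># lab_sum f (Ls ! k)" .
    show ?thesis using a unfolding L M
      using k len
      by (simp add: sum_list_split[of k Ls] sum_list_split2[of k ss] del: lab_sub.simps branch_var.simps)
        (auto simp: subseteq_mset_def intro: trans_le_add1 trans_le_add2 simp del: lab_sub.simps branch_var.simps)
  qed
  ultimately show ?case by blast
next
  case (2 Ss k k' P Ts)
  obtain ss Ls where L: "L = Lab ss Ls" by (cases L)
  obtain ts Ms where M: "M = Lab ts Ms" by (cases M)
  from 2(5) obtain T where T: "Ts = [T]" "branch_height (k' # P) \<le> trunk_height T"
    by (auto simp: branch_height_def elim: trunk_height_SucE)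
  from 2 L have k: "k < length Ss" "length ss = Suc (length Ss)" "list_all2 labelling Ss Ls"
    by auto
  then have len: "length Ls = length Ss" by (auto dest: list_all2_lengthD)
  from 2(7) M T obtain t0 t1 N where ts: "ts = [t0, t1]" "Ms = [N]" "labelling T N"
    by (auto simp: length_Suc_conv list_all2_Cons1)
  have lk: "labelling (Ss ! k) (Ls ! k)" using k by (auto simp: list_all2_conv_all_nth)
  have paths: "is_path (Ss ! k) (k' # P)" "linear (subtree (Ss ! k) (k' # P))" using 2 by auto
  let ?x = "branch_var (Ss ! k) (k' # P)" and ?I = "insert_lab (Ls ! k) (k' # P) N"
  have "branch_height (k' # P) \<le> trunk_height (hd Ts)" "labelling (hd Ts) N"
    using T ts by simp_all
  note IH = 2(1)[OF paths _ this(1) lk this(2)]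
  have I: "labelling (insert_tree (Ss ! k) (k' # P) T) ?I" using IH T by simp
  have "labelling (insert_tree (Tree Ss) (k # k' # P) (Tree Ts)) (insert_lab L (k # k' # P) M)"
    using k len I unfolding L M ts T
    by (auto intro!: list_all2_appendI list_all2_takeI list_all2_dropI)
  moreover have "lab_all (insert_lab L (k # k' # P) M) Q" if "lab_all L Q" "lab_all M Q"
  proof -
    have "lab_all ?I (\<lambda>d. Q (Suc d))"
      using IH[of "\<lambda>d. Q (Suc d)"] that k len by (simp add: L M ts list_all_iff)
    then show ?thesis
      using that unfolding L M ts by (auto simp: list_all_iff dest: in_set_takeD in_set_dropD)
  qed
  moreover have "lab_sum f (insert_lab L (k # k' # P) M) +
      f (lab_sub L ! branch_var (Tree Ss) (k # k' # P)) \<subseteq># lab_sum f L + lab_sum f M"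
  proof -
    have "?x < length (tree_dims (Ss ! k))" using branch_var_dim[OF paths] by simp
    then have x: "lab_sub L ! branch_var (Tree Ss) (k # k' # P) = lab_sub (Ls ! k) ! ?x"
      using lab_sub_child_var[of Ss ss Ls k ?x] 2(6) k by (simp add: L del: lab_sub.simps)
    have "lab_sum f ?I + f (lab_sub (Ls ! k) ! ?x) \<subseteq># lab_sum f (Ls ! k) + lab_sum f N"
      using IH by simp
    then have "\<exists>R. lab_sum f (Ls ! k) + lab_sum f N = lab_sum f ?I + f (lab_sub (Ls ! k) ! ?x) + R"
      by (simp add: subset_mset.le_iff_add)
    then obtain R where
      R: "lab_sum f (Ls ! k) + lab_sum f N = lab_sum f ?I + f (lab_sub (Ls ! k) ! ?x) + R" ..
    \<comment> \<open>The points of \<open>L\<close> on either side of child \<open>k\<close> give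
      way to \<open>t0\<close> and \<open>t1\<close>; they join \<open>R\<close> in the
      remainder.\<close>
    have "lab_sum f L + lab_sum f M =
        lab_sum f (insert_lab L (k # k' # P) M) + f (lab_sub (Ls ! k) ! ?x) +
        (R + f (ss ! k) + f (ss ! Suc k))"
      using k len arg_cong[OF R, of "\<lambda>Y. Y + (sum_list (map f ss) + sum_list (map f ts) +
        sum_list (map (lab_sum f) (take k Ls)) + sum_list (map (lab_sum f) (drop (Suc k) Ls)))"]
      unfolding L M ts
      by (simp add: sum_list_split[of k Ls] sum_list_split2[of k ss] ac_simps
          del: lab_sub.simps branch_var.simps)
    then show ?thesis unfolding x by simp
  qed
  ultimately show ?case by blast
qed simp_all

text \<open>The branch variable is sent to the standard coherence over \<open>T\<close> in the
  dimension of the leaf; the last hypothesis is the dimension clause for this coherence.\<close>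

lemma wd_ext_sub:
  assumes "is_path S P" "linear (subtree S P)" "P \<noteq> []" "branch_height P \<le> trunk_height T"
    and "tree_dim T \<le> length P + tree_dim (subtree S P)"
  shows "list_all2 (wd_tm (tree_dims (insert_tree S P T))) (tree_dims S) (ext_sub S P T)"
  using assms
proof (induction S P T rule: insert_tree.induct)
  case (1 Ss k Ts)
  let ?l = "leaf_height (Tree Ss) [k]"
  let ?D = "disc_sub (std_ty ?l (Tree Ts)) (std_coh ?l (Tree Ts))"
  from 1 have k: "k < length Ss" and lin: "linear (Ss ! k)" by auto
  have l: "?l = Suc (tree_dim (Ss ! k))" using leaf_height_eq[of "Tree Ss" "[k]"] k lin by simp
  have "list_all2 (wd_tm (tree_dims (Tree Ts))) (tree_dims (disc ?l)) ?D"
    using wd_disc_sub[OF wd_std_ty[of "Tree Ts" ?l]] wd_std_coh[of "Tree Ts" ?l] 1 l by simp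
  \<comment> \<open>The suspension of a linear tree is a disc, so the domain of \<open>?D\<close> is
    the factor of \<open>Ss ! k\<close> in the wedge.\<close>
  moreover have "disc ?l = Tree [Ss ! k]" using linear_disc[OF lin] l by simp
  ultimately have "list_all2 (wd_tm (tree_dims (Tree Ts))) (tree_dims (Tree [Ss ! k])) ?D" by simp
  note wd = wd_wedge_sub[OF _ wd_wedge_sub[OF _ _ pointed_tree_ctx pointed_tree_ctx]
      pointed_tree_ctx pointed_wedge[OF pointed_tree_ctx], unfolded dims_wedge dims_tree_ctx,
      OF wd_id_sub this wd_id_sub, of "Tree (take k Ss)" "Tree (drop (Suc k) Ss)"]
  have "tree_dims (Tree Ss) = tree_dims (Tree (take k Ss @ Ss ! k # drop (Suc k) Ss))"
    using k by (simp only: id_take_nth_drop[symmetric])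
  with wd show ?case by (simp add: Let_def)
next
  case (2 Ss k k' P Ts)
  let ?I = "insert_tree (Ss ! k) (k' # P) (hd Ts)"
  from 2(5) obtain T where T: "Ts = [T]" "branch_height (k' # P) \<le> trunk_height T"
    by (auto simp: branch_height_def elim: trunk_height_SucE)
  from 2 have k: "k < length Ss" by auto
  have "list_all2 (wd_tm (tree_dims ?I)) (tree_dims (Ss ! k)) (ext_sub (Ss ! k) (k' # P) (hd Ts))"
    using 2 T by (intro "2.IH") auto
  from wd_susp_sub[OF this]
  have "list_all2 (wd_tm (map ty_dim (susp_ctx (tree_ctx ?I)))) (tree_dims (Tree [Ss ! k]))
      (susp_sub (ext_sub (Ss ! k) (k' # P) (hd Ts)))"
    by (simp add: dims_susp_ctx)
  note wd = wd_wedge_sub[OF _ wd_wedge_sub[OF _ _ pointed_susp_ctx pointed_tree_ctx]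
      pointed_tree_ctx pointed_wedge[OF pointed_susp_ctx], unfolded dims_wedge dims_tree_ctx,
      OF wd_id_sub this wd_id_sub, of "Tree (take k Ss)" "Tree (drop (Suc k) Ss)"]
  have "tree_dims (Tree Ss) = tree_dims (Tree (take k Ss @ Ss ! k # drop (Suc k) Ss))"
    using k by (simp only: id_take_nth_drop[symmetric])
  with wd show ?case by (simp add: Let_def dims_susp_ctx)
qed simp_all

section \<open>The dimension discipline is preserved by reduction\<close>

lemma insertion_wd:
  assumes "insertion a s t" "wd_tm ds n s"
  shows "wd_tm ds n t"
  using assms(1)
proof cases
  case (1 S P T L M A)
  then have br: "is_path S P" "linear (subtree S P)" "P \<noteq> []"
    and th: "branch_height P \<le> trunk_height T" and lh: "tree_dim T \<le> leaf_height S P"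
    and L: "labelling S L" and M: "labelling T M"
    and arg: "lab_sub L ! branch_var S P = sub_tm (std_coh (leaf_height S P) T) (lab_sub M)"
    by (auto simp: insertion_redex_def insertion_point_def is_branch_def)
  \<comment> \<open>The second conjunct carries the dimension clause of \<open>wd_Coh\<close>
    through the insertion: the dimensions of the new tree are read off from its labelling.\<close>
  let ?Q = "\<lambda>d t. wd_tm ds d t \<and> d \<le> ty_dim A"
  from assms(2) 1 have dim: "ty_dim A \<le> n" and dims: "\<forall>d \<in> set (tree_dims S). d \<le> ty_dim A"
    and A: "wd_ty (tree_dims S) A" and wdL: "list_all2 (wd_tm ds) (tree_dims S) (lab_sub L)"
    by (auto simp flip: dims_tree_ctx simp del: length_tree_ctx)
  from wdL dims have L_all: "lab_all L ?Q"
    unfolding lab_sub_all[OF L, symmetric] by (auto simp: list_all2_conv_all_nth)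
  note bv = branch_var_dim[OF br(1,2)] and lh_eq = leaf_height_eq[OF br(1,2)]
  have lh_bv: "tree_dims S ! branch_var S P = leaf_height S P" using bv lh_eq by simp
  \<comment> \<open>The inserted argument is a coherence whose arguments are the labels of
    \<open>M\<close>, so the bounds for \<open>M\<close> are extracted from it.\<close>
  have "wd_tm ds (tree_dims S ! branch_var S P) (lab_sub L ! branch_var S P)"
    using bv wdL by (blast intro: list_all2_nthD)
  then have "wd_tm ds (leaf_height S P) (sub_tm (std_coh (leaf_height S P) T) (lab_sub M))"
    unfolding lh_bv arg .
  then have "list_all2 (wd_tm ds) (tree_dims T) (lab_sub M)"
    by (simp add: std_coh_sub[OF length_lab_sub[OF M]])
  moreover have "d \<le> ty_dim A" if "d \<in> set (tree_dims T)" for d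
  proof -
    have "d \<le> leaf_height S P" using tree_dims_bound[OF that] lh by simp
    also have "\<dots> \<le> ty_dim A" using bv dims unfolding lh_bv[symmetric] by (blast intro: nth_mem)
    finally show ?thesis .
  qed
  ultimately have M_all: "lab_all M ?Q"
    unfolding lab_sub_all[OF M, symmetric] by (auto simp: list_all2_conv_all_nth)
  from insert_lab[OF br th L M, of ?Q "\<lambda>_. {#} :: nat multiset"] L_all M_all
  have ins: "list_all2 ?Q (tree_dims (insert_tree S P T)) (lab_sub (insert_lab L P M))"
    by (simp add: lab_sub_all)
  have "\<forall>d \<in> set (tree_dims (insert_tree S P T)). d \<le> ty_dim A"
    using ins by (fastforce simp: list_all2_conv_all_nth in_set_conv_nth)
  moreover have "list_all2 (wd_tm ds) (tree_dims (insert_tree S P T)) (lab_sub (insert_lab L P M))"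
    using ins by (rule list_all2_mono) simp
  moreover have "wd_ty (tree_dims (insert_tree S P T)) (sub_ty A (ext_sub S P T))"
    using A wd_ext_sub[OF br th] lh lh_eq by (auto intro: wd_ty_sub)
  ultimately show ?thesis using dim 1 by (auto dest: ty_dim_in_tree_dims)
qed

lemma wd_std_coh_disc_sub:
  assumes "n \<le> m" "wd_ty ds A" "wd_tm ds (ty_dim A) t" "n = ty_dim A"
  shows "wd_tm ds m (sub_tm (std_coh m (disc n)) (disc_sub A t))"
  unfolding assms(4)
  by (rule wd_tm_sub[OF wd_std_coh wd_disc_sub[OF assms(2,3)]]) (use assms in simp)

lemma endo_removal_wd:
  assumes "endo_removal s t" "wd_tm ds n s"
  shows "wd_tm ds n t"
  using assms(1)
proof cases
  case (1 m A \<Delta> u \<sigma>)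
  with assms(2) have "wd_ty ds (sub_ty A \<sigma>)" "wd_tm ds (ty_dim (sub_ty A \<sigma>)) (sub_tm u \<sigma>)"
    by (auto intro: wd_ty_sub wd_tm_sub)
  then have "wd_tm ds (Suc m) t" unfolding 1(2) using 1(3) by (intro wd_std_coh_disc_sub) simp_all
  moreover have "Suc m \<le> n" using assms(2) 1 by simp
  ultimately show ?thesis by (rule wd_tm_mono)
qed

lemma sub_std_coh_disc_sub:
  "n = ty_dim A \<Longrightarrow> sub_tm (std_coh m (disc n)) (disc_sub A t) =
    Coh (tree_ctx (disc n)) (std_ty m (disc n)) (disc_sub A t)"
  by (simp add: std_coh_sub)

lemma disc_removal_wd:
  assumes "disc_removal s t" "wd_tm ds n s"
  shows "wd_tm ds n t"
  using assms(1)
proof cases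
  case (1 m A)
  with assms(2) have "m \<le> n" "list_all2 (wd_tm ds) (tree_dims (disc m)) (disc_sub A t)"
    by (simp_all add: sub_std_coh_disc_sub)
  from list_all2_nthD[OF this(2), of "2 * m"] have "wd_tm ds m t"
    using 1 by (simp add: disc_sub_def nth_append)
  then show ?thesis using \<open>m \<le> n\<close> by (rule wd_tm_mono)
qed

lemma
  shows red_ty_wd: "red_ty A B \<Longrightarrow> ty_dim B = ty_dim A \<and> (\<forall>ds. wd_ty ds A \<longrightarrow> wd_ty ds B)"
    and red_tm_wd: "red_tm s t \<Longrightarrow> \<forall>ds n. wd_tm ds n s \<longrightarrow> wd_tm ds n t"
    and red_sub_wd: "red_sub \<sigma> \<tau> \<Longrightarrow> length \<tau> = length \<sigma> \<and>
      (\<forall>ds es. list_all2 (wd_tm ds) es \<sigma> \<longrightarrow> list_all2 (wd_tm ds) es \<tau>)"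
proof (induction rule: red_ty_red_tm_red_sub.inducts)
  case (red_sub_at t t' \<sigma> \<tau>)
  have "list_all2 (wd_tm ds) es (\<sigma> @ t' # \<tau>)" if "list_all2 (wd_tm ds) es (\<sigma> @ t # \<tau>)" for ds es
  proof -
    from that obtain us z zs where "es = us @ z # zs" "list_all2 (wd_tm ds) us \<sigma>" "wd_tm ds z t"
      "list_all2 (wd_tm ds) zs \<tau>"
      by (auto simp: list_all2_append2 list_all2_Cons2)
    then show ?thesis using red_sub_at by (auto intro!: list_all2_appendI)
  qed
  then show ?case by simp
qed (auto simp: disc_removal_wd endo_removal_wd insertion_wd)

section \<open>Syntactic complexity\<close>

primrec sc_ty :: "ty \<Rightarrow> nat multiset" and sc_tm :: "tm \<Rightarrow> nat multiset" where
  "sc_ty Star = {#}"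
| "sc_ty (Arr s A t) = {#}"
| "sc_tm (Var i) = {#}"
| "sc_tm (Coh \<Delta> A \<sigma>) =
     (if is_identity (Coh \<Delta> A \<sigma>) then {#ty_dim A#} else {#ty_dim A, ty_dim A#}) +
     sum_list (map sc_tm \<sigma>)"

lemma sc_Coh_pos: "{#ty_dim A#} + sum_list (map sc_tm \<sigma>) \<subseteq># sc_tm (Coh \<Delta> A \<sigma>)"
  by simp

text \<open>Arguments fill variables of \<open>\<Delta>\<close>, of dimension at most that of
  \<open>A\<close>, so the entry of the outermost coherence dominates all others.\<close>

lemma sc_bound: "wd_tm ds n t \<Longrightarrow> x \<in># sc_tm t \<Longrightarrow> x \<le> n"
proof (induction rule: wd_ty_wd_tm.inducts(2)[where ?P1.0 = "\<lambda>_ _. True"])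
  case (wd_Coh A n \<Delta> ds \<sigma>)
  show ?case
  proof (cases "x = ty_dim A")
    case False
    with wd_Coh obtain i where "i < length \<sigma>" "x \<in># sc_tm (\<sigma> ! i)"
      by (auto simp: in_set_conv_nth split: if_splits)
    with wd_Coh.IH have "x \<le> ty_dim (\<Delta> ! i)" "i < length \<Delta>"
      by (auto simp: list_all2_conv_all_nth)
    moreover from this(2) have "ty_dim (\<Delta> ! i) \<le> ty_dim A" using wd_Coh.hyps(2) by simp
    ultimately show ?thesis using wd_Coh.hyps(1) by linarith
  qed (use wd_Coh in simp)
qed simp_all

text \<open>Only the length of the substitution enters, so reducing an argument neither creates nor
  destroys an identity.\<close>

lemma is_identity_iff:
  "is_identity (Coh \<Delta> A \<sigma>) \<longleftrightarrow>
    (\<exists>n. \<Delta> = tree_ctx (disc n) \<and> A = std_ty (Suc n) (disc n) \<and> length \<sigma> = length \<Delta>)"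
  unfolding is_identity_def
  by (auto simp: std_coh_sub simp del: std_ty.simps std_tm.simps)
    (metis length_tree_dims_disc std_coh_sub)

section \<open>Irreducibility of the types of identities\<close>

primrec var_ty :: "ty \<Rightarrow> bool" where
  "var_ty Star \<longleftrightarrow> True"
| "var_ty (Arr s A t) \<longleftrightarrow> (\<exists>i j. s = Var i \<and> t = Var j) \<and> var_ty A"

lemma not_red_Var: "\<not> red_tm (Var i) t"
  by (auto elim!: red_tm.cases disc_removal.cases endo_removal.cases insertion.cases simp: std_coh_def)

lemma not_red_var_ty: "var_ty A \<Longrightarrow> \<not> red_ty A B"
  by (induction A arbitrary: B rule: ty.induct[where ?P2.0 = "\<lambda>_. True"])
    (auto elim: red_ty.cases simp: not_red_Var)

text \<open>For \<open>k \<le> n\<close> the \<open>k\<close>-boundary of a disc is again a disc, so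
  its standard term is the top variable and the inclusion sends it to a variable. The case
  \<open>k = n\<close> accounts for the bound \<open>Suc n\<close>.\<close>

lemma var_ty_std_disc: "m \<le> Suc n \<Longrightarrow> var_ty (std_ty m (disc n))"
proof (induction m)
  case (Suc k)
  have "\<exists>i. bdry_incl \<epsilon> k (disc n) ! (2 * k) = Var i" for \<epsilon>
    using list_all2_nthD[OF vars_of_bdry_incl[of "disc n" k \<epsilon>], of "2 * k"] Suc
    by (auto simp: bdry_disc var_of_def)
  then show ?case using Suc by (simp add: bdry_disc)
qed simp

text \<open>Excludes the one way in which reduction inside a type could raise the complexity: an
  identity, counted once, turning into a non-identity, counted twice.\<close>

lemma not_red_identity_ty: "is_identity (Coh \<Delta> A \<sigma>) \<Longrightarrow> \<not> red_ty A B"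
  by (metis is_identity_iff not_red_var_ty order_refl var_ty_std_disc)

text \<open>
  The reductions inside the type of a coherence are the only ones that need not decrease the
  complexity. They take place among terms of smaller dimension than the coherence.
\<close>

inductive cell_red :: "tm \<Rightarrow> tm \<Rightarrow> bool" where
  cell_ty: "red_ty A B \<Longrightarrow> cell_red (Coh \<Delta> A \<sigma>) (Coh \<Delta> B \<sigma>)"
| cell_arg: "cell_red t t' \<Longrightarrow> cell_red (Coh \<Delta> A (\<sigma> @ t # \<tau>)) (Coh \<Delta> A (\<sigma> @ t' # \<tau>))"

section \<open>Decrease of the complexity\<close>

lemma add_smaller_multiset:
  fixes M N :: "nat multiset"
  assumes "\<And>x. x \<in># N \<Longrightarrow> x < n"
  shows "M + N < add_mset n M"
  using one_step_implies_mult[of "{#n#}" N "{(x, y). x < y}" M] assms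
  by (auto simp: less_multiset_def multp_def)

lemma disc_removal_sc:
  assumes "disc_removal s t"
  shows "sc_tm t < sc_tm s"
  using assms
proof cases
  case (1 n A)
  have "sc_tm t \<subseteq># sum_list (map sc_tm (disc_sub A t))" by (simp add: disc_sub_def)
  also have "\<dots> \<subset># {#n#} + sum_list (map sc_tm (disc_sub A t))" by simp
  also have "\<dots> \<subseteq># sc_tm s"
    using sc_Coh_pos[of "std_ty n (disc n)" "disc_sub A t" "tree_ctx (disc n)"] 1
    by (simp only: sub_std_coh_disc_sub ty_dim_std_ty)
  finally show ?thesis by (rule subset_imp_less_mset)
qed

text \<open>In the multiset order, giving up one of two copies of \<open>Suc m\<close> pays for any
  number of entries at most \<open>m\<close>. So it does not matter how often \<open>A\<close> and
  \<open>u\<close> copy the arguments in \<open>\<sigma>\<close>.\<close>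

lemma endo_removal_sc:
  assumes "endo_removal s t" "\<not> is_identity s" "wd_tm ds n s"
  shows "sc_tm t < sc_tm s"
  using assms(1)
proof cases
  case (1 m A \<Delta> u \<sigma>)
  let ?D = "disc_sub (sub_ty A \<sigma>) (sub_tm u \<sigma>)"
  from assms(3) 1 have wd: "list_all2 (wd_tm ds) (tree_dims (disc m)) ?D"
    by (auto simp del: tree_dims.simps intro!: wd_disc_sub[where A = "sub_ty A \<sigma>", simplified] wd_ty_sub wd_tm_sub)
  have small: "x < Suc m" if x: "x \<in># sum_list (map sc_tm ?D)" for x
  proof -
    from x obtain i where i: "i < length ?D" "x \<in># sc_tm (?D ! i)"
      by (auto simp: in_set_conv_nth)
    then have "i < length (tree_dims (disc m))" using wd by (metis list_all2_lengthD)
    then have "tree_dims (disc m) ! i \<le> m" "wd_tm ds (tree_dims (disc m) ! i) (?D ! i)"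
      using wd nth_mem[of i "tree_dims (disc m)"] by (auto simp: list_all2_nthD tree_dims_disc)
    with sc_bound[OF this(2) i(2)] show ?thesis by simp
  qed
  have "is_identity (Coh (tree_ctx (disc m)) (std_ty (Suc m) (disc m)) ?D)"
    using 1 by (auto simp: is_identity_iff)
  then have "sc_tm t = {#Suc m#} + sum_list (map sc_tm ?D)"
    using 1 by (simp add: sub_std_coh_disc_sub del: std_ty.simps)
  also have "\<dots> < add_mset (Suc m) {#Suc m#}" by (rule add_smaller_multiset[OF small])
  also have "\<dots> \<le> sc_tm s" using 1 assms(2) by (intro subset_eq_imp_le_multiset) simp
  finally show ?thesis .
qed

text \<open>The deleted argument weighs at least its own dimension plus all of \<open>M\<close>. Its
  deletion therefore pays for the arrival of the labels of \<open>M\<close>, and its own entry is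
  the strict gain.\<close>

lemma insertion_sc:
  assumes "insertion a s t" "\<not> is_identity s"
  shows "sc_tm t < sc_tm s"
  using assms(1)
proof cases
  case (1 S P T L M A)
  then have br: "is_path S P" "linear (subtree S P)" "P \<noteq> []"
    and th: "branch_height P \<le> trunk_height T"
    and L: "labelling S L" and M: "labelling T M"
    and arg: "lab_sub L ! branch_var S P = sub_tm (std_coh (leaf_height S P) T) (lab_sub M)"
    by (auto simp: insertion_redex_def insertion_point_def is_branch_def)
  note ins = insert_lab[OF br th L M, of _ sc_tm]
  have "sc_tm (lab_sub L ! branch_var S P) \<supseteq># {#leaf_height S P#} + lab_sum sc_tm M"
    unfolding arg std_coh_sub[OF length_lab_sub[OF M]] lab_sub_sum[OF M, symmetric]
    using sc_Coh_pos[of "std_ty (leaf_height S P) T"] by simp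
  then have "lab_sum sc_tm (insert_lab L P M) + ({#leaf_height S P#} + lab_sum sc_tm M) \<subseteq>#
      lab_sum sc_tm L + lab_sum sc_tm M"
    using ins by (meson subset_mset.add_left_mono subset_mset.order_trans)
  then have "add_mset (leaf_height S P) (lab_sum sc_tm (insert_lab L P M)) \<subseteq># lab_sum sc_tm L"
    by simp
  then have "lab_sum sc_tm (insert_lab L P M) \<subset># lab_sum sc_tm L"
    by (rule subset_mset.less_le_trans[rotated]) simp
  then have less: "lab_sum sc_tm (insert_lab L P M) < lab_sum sc_tm L"
    by (rule subset_imp_less_mset)
  have "labelling (insert_tree S P T) (insert_lab L P M)" using ins by blast
  \<comment> \<open>Only an inequality: the result may be an identity, whereas \<open>s\<close> is
    counted twice.\<close>
  then have "sc_tm t \<le> {#ty_dim A, ty_dim A#} + lab_sum sc_tm (insert_lab L P M)"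
    using 1 by (intro subset_eq_imp_le_multiset) (simp add: lab_sub_sum)
  also have "\<dots> < {#ty_dim A, ty_dim A#} + lab_sum sc_tm L" using less by simp
  also have "\<dots> = sc_tm s" using 1 assms(2) L by (simp add: lab_sub_sum)
  finally show ?thesis .
qed

lemma sc_cong:
  assumes "length \<tau> = length \<sigma>"
  shows "sum_list (map sc_tm \<tau>) < sum_list (map sc_tm \<sigma>) \<Longrightarrow>
      sc_tm (Coh \<Delta> A \<tau>) < sc_tm (Coh \<Delta> A \<sigma>)"
    and "sum_list (map sc_tm \<tau>) \<le> sum_list (map sc_tm \<sigma>) \<Longrightarrow>
      sc_tm (Coh \<Delta> A \<tau>) \<le> sc_tm (Coh \<Delta> A \<sigma>)"
  using assms by (simp_all add: is_identity_iff)

text \<open>\<open>cell_red\<close> relates terms, so for a substitution the second alternative is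
  stated inside an arbitrary coherence.\<close>

lemma red_sc:
  shows "red_ty A B \<Longrightarrow> True"
    and "red_tm s t \<Longrightarrow> \<forall>ds n. wd_tm ds n s \<longrightarrow>
      sc_tm t < sc_tm s \<or> cell_red s t \<and> sc_tm t \<le> sc_tm s"
    and "red_sub \<sigma> \<tau> \<Longrightarrow> \<forall>ds es. list_all2 (wd_tm ds) es \<sigma> \<longrightarrow>
      sum_list (map sc_tm \<tau>) < sum_list (map sc_tm \<sigma>) \<or>
      (\<forall>\<Delta> A. cell_red (Coh \<Delta> A \<sigma>) (Coh \<Delta> A \<tau>)) \<and>
        sum_list (map sc_tm \<tau>) \<le> sum_list (map sc_tm \<sigma>)"
proof (induction rule: red_ty_red_tm_red_sub.inducts)
  case (red_coh_ty A B \<Delta> \<sigma>)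
  then have "\<not> is_identity (Coh \<Delta> A \<sigma>)" "ty_dim B = ty_dim A"
    using not_red_identity_ty red_ty_wd by auto
  then have "sc_tm (Coh \<Delta> B \<sigma>) \<le> sc_tm (Coh \<Delta> A \<sigma>)"
    by (intro subset_eq_imp_le_multiset) simp
  with red_coh_ty show ?case by (auto intro: cell_ty)
next
  case (red_coh_sub \<sigma> \<tau> \<Delta> A)
  then show ?case
    using sc_cong[of \<tau> \<sigma>] red_sub_wd(1) by (auto simp del: sc_tm.simps)
next
  case (red_sub_at t t' \<sigma> \<tau>)
  show ?case
  proof (intro allI impI)
    fix ds es assume "list_all2 (wd_tm ds) es (\<sigma> @ t # \<tau>)"
    then have "\<exists>n. wd_tm ds n t" by (auto simp: list_all2_append2 list_all2_Cons2)
    with red_sub_at.IH have "sc_tm t' < sc_tm t \<or> cell_red t t' \<and> sc_tm t' \<le> sc_tm t" by blast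
    then show "sum_list (map sc_tm (\<sigma> @ t' # \<tau>)) < sum_list (map sc_tm (\<sigma> @ t # \<tau>)) \<or>
      (\<forall>\<Delta> A. cell_red (Coh \<Delta> A (\<sigma> @ t # \<tau>)) (Coh \<Delta> A (\<sigma> @ t' # \<tau>))) \<and>
        sum_list (map sc_tm (\<sigma> @ t' # \<tau>)) \<le> sum_list (map sc_tm (\<sigma> @ t # \<tau>))"
      by (auto intro: cell_arg)
  qed
qed (auto simp: disc_removal_sc endo_removal_sc insertion_sc)

section \<open>Strong normalisation\<close>

abbreviation sn :: "('a \<Rightarrow> 'a \<Rightarrow> bool) \<Rightarrow> 'a set" where
  "sn R \<equiv> Wellfounded.acc {(y, x). R x y}"

lemma snI: "(\<And>y. R x y \<Longrightarrow> y \<in> sn R) \<Longrightarrow> x \<in> sn R"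
  by (rule accI) simp

lemma sn_induct [consumes 1, case_names step]:
  assumes "a \<in> sn R" "\<And>x. x \<in> sn R \<Longrightarrow> (\<And>y. R x y \<Longrightarrow> P y) \<Longrightarrow> P x"
  shows "P a"
  using assms(1) by (rule acc_induct) (use assms(2) in blast)

lemma sn_no_infinite_chain:
  assumes "x \<in> sn R"
  shows "\<not> (\<exists>f. f 0 = x \<and> (\<forall>i. R (f i) (f (Suc i))))"
  using assms
proof (induction rule: sn_induct)
  case (step x)
  show ?case
  proof
    assume "\<exists>f. f 0 = x \<and> (\<forall>i. R (f i) (f (Suc i)))"
    then obtain f where f: "f 0 = x" "\<And>i. R (f i) (f (Suc i))" by blast
    from f(2)[of 0] f(1) have "R x (f (Suc 0))" by simp
    from step(2)[OF this] f(2) show False by (auto dest: spec[of _ "\<lambda>i. f (Suc i)"])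
  qed
qed

lemma sn_listI:
  assumes "\<And>t. t \<in> set \<sigma> \<Longrightarrow> t \<in> sn R"
  shows "\<sigma> \<in> sn (\<lambda>\<sigma> \<tau>. (\<tau>, \<sigma>) \<in> listrel1 {(t', t). R t t'})"
proof -
  have "\<sigma> \<in> Wellfounded.acc (listrel1 {(t', t). R t t'})"
    using assms by (intro lists_accD) (auto simp: in_lists_conv_set)
  then show ?thesis by simp
qed

text \<open>Nested induction for independent components: \<open>y\<close> stays general in the outer
  induction because a step in \<open>x\<close> keeps the current \<open>y\<close>.\<close>

lemma sn_pair:
  assumes "x \<in> sn R" "y \<in> sn S"
    and step: "\<And>x y z. Q (f x y) z \<Longrightarrow>
      (\<exists>x'. R x x' \<and> z = f x' y) \<or> (\<exists>y'. S y y' \<and> z = f x y')"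
  shows "f x y \<in> sn Q"
  using assms(1,2)
proof (induction x arbitrary: y rule: sn_induct)
  case x: (step x)
  from x.prems show ?case
  proof (induction y rule: sn_induct)
    case y: (step y)
    show ?case
    proof (rule snI)
      fix z assume "Q (f x y) z"
      from step[OF this] show "z \<in> sn Q" using x.IH y by blast
    qed
  qed
qed

lemma sn_cell_Coh:
  assumes "A \<in> sn red_ty" "\<And>t. t \<in> set \<sigma> \<Longrightarrow> t \<in> sn cell_red"
  shows "Coh \<Delta> A \<sigma> \<in> sn cell_red"
proof (rule sn_pair[where f = "Coh \<Delta>", OF assms(1) sn_listI[OF assms(2)]])
  fix A \<sigma> z assume "cell_red (Coh \<Delta> A \<sigma>) z"
  then show "(\<exists>B. red_ty A B \<and> z = Coh \<Delta> B \<sigma>) \<or>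
      (\<exists>\<tau>. (\<tau>, \<sigma>) \<in> listrel1 {(t', t). cell_red t t'} \<and> z = Coh \<Delta> A \<tau>)"
    by cases (auto intro!: listrel1I)
qed

lemma sn_Arr:
  assumes "s \<in> sn red_tm" "A \<in> sn red_ty" "t \<in> sn red_tm"
  shows "Arr s A t \<in> sn red_ty"
proof -
  \<comment> \<open>Steps in one component of a pair, so that two uses of \<open>sn_pair\<close>
    handle the three components of an arrow.\<close>
  define Q where "Q p q \<longleftrightarrow> red_ty (fst p) (fst q) \<and> snd q = snd p \<or>
    fst q = fst p \<and> red_tm (snd p) (snd q)" for p q
  have "(A, t) \<in> sn Q"
    using assms(2,3) by (rule sn_pair) (auto simp: Q_def)
  with assms(1) have "(\<lambda>s p. Arr s (fst p) (snd p)) s (A, t) \<in> sn red_ty"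
    by (rule sn_pair) (auto simp: Q_def elim: red_ty.cases)
  then show ?thesis by simp
qed

text \<open>The assumption on types ranges over all \<open>ds\<close>, since the type of each nested
  coherence lives over that coherence's own context.\<close>

lemma sn_cell_red:
  assumes "wd_tm ds n t" "\<And>ds A. wd_ty ds A \<Longrightarrow> ty_dim A \<le> n \<Longrightarrow> A \<in> sn red_ty"
  shows "t \<in> sn cell_red"
  using assms
proof (induction rule: wd_ty_wd_tm.inducts(2)[where ?P1.0 = "\<lambda>_ _. True"])
  case (wd_Var i ds n)
  show ?case by (rule snI) (auto elim: cell_red.cases)
next
  case (wd_Coh A n \<Delta> ds \<sigma>)
  show ?case
  proof (rule sn_cell_Coh)
    show "A \<in> sn red_ty" using wd_Coh.hyps(1,3) by (intro wd_Coh.prems)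
  next
    fix t assume "t \<in> set \<sigma>"
    then obtain i where i: "i < length \<sigma>" "t = \<sigma> ! i" by (auto simp: in_set_conv_nth)
    moreover have "length \<sigma> = length \<Delta>" using wd_Coh.IH by (simp add: list_all2_conv_all_nth)
    ultimately have "ty_dim (\<Delta> ! i) \<le> n" using wd_Coh.hyps(1,2) by (simp add: order_trans[of _ "ty_dim A"])
    with wd_Coh.prems have "\<And>ds A. wd_ty ds A \<Longrightarrow> ty_dim A \<le> ty_dim (\<Delta> ! i) \<Longrightarrow> A \<in> sn red_ty"
      using order_trans by blast
    with list_all2_nthD2[OF wd_Coh.IH i(1)] i \<open>length \<sigma> = length \<Delta>\<close> show "t \<in> sn cell_red"
      by simp
  qed
qed simp_all

lemma sn_red_tm_if_cells:
  assumes "wd_tm ds n t" "\<And>t. wd_tm ds n t \<Longrightarrow> t \<in> sn cell_red"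
  shows "t \<in> sn red_tm"
  using assms(1)
proof (induction "sc_tm t" arbitrary: t rule: less_induct)
  case less
  \<comment> \<open>The lexicographic induction: \<open>sc_tm u \<le> sc_tm t\<close> is kept by
    steps inside types, and any strict drop from \<open>u\<close> falls below \<open>t\<close>,
    where the outer hypothesis applies.\<close>
  have "u \<in> sn red_tm" if "u \<in> sn cell_red" "wd_tm ds n u" "sc_tm u \<le> sc_tm t" for u
    using that
  proof (induction rule: sn_induct)
    case (step u)
    show ?case
    proof (rule snI)
      fix v assume uv: "red_tm u v"
      then have v: "wd_tm ds n v" using red_tm_wd step.prems(1) by blast
      from red_sc(2)[OF uv] step.prems(1)
      consider "sc_tm v < sc_tm u" | "cell_red u v" "sc_tm v \<le> sc_tm u" by blast
      then show "v \<in> sn red_tm"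
      proof cases
        case 1
        then show ?thesis using less.hyps v step.prems(2) by (meson less_le_trans)
      next
        case 2
        then show ?thesis using step v by (meson order_trans)
      qed
    qed
  qed
  then show ?case using less.prems assms(2) by blast
qed

text \<open>A type of dimension at most \<open>n\<close> has its sources and targets in dimensions
  below \<open>n\<close>. So the induction hypothesis normalises types, hence
  \<open>cell_red\<close>, hence terms of dimension \<open>n\<close>.\<close>

lemma wd_tm_sn: "wd_tm ds n t \<Longrightarrow> t \<in> sn red_tm"
proof (induction n arbitrary: ds t rule: less_induct)
  case (less n)
  have types: "A \<in> sn red_ty" if "wd_ty ds A" "ty_dim A \<le> n" for ds A
    using that
  proof (induction rule: wd_ty_wd_tm.inducts(1)[where ?P2.0 = "\<lambda>_ _ _. True"])
    case (wd_Star ds)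
    show ?case by (rule snI) (auto elim: red_ty.cases)
  next
    case (wd_Arr ds A s t)
    then show ?case using less.IH[of "ty_dim A"] by (intro sn_Arr) auto
  qed simp_all
  show ?case
    by (rule sn_red_tm_if_cells[OF less.prems sn_cell_red]) (use types in auto)
qed

lemma wd_ty_sn: "wd_ty ds A \<Longrightarrow> A \<in> sn red_ty"
proof (induction rule: wd_ty_wd_tm.inducts(1)[where ?P2.0 = "\<lambda>_ _ _. True"])
  case (wd_Star ds)
  show ?case by (rule snI) (auto elim: red_ty.cases)
next
  case (wd_Arr ds A s t)
  then show ?case by (intro sn_Arr) (auto intro: wd_tm_sn)
qed simp_all

lemma wd_sub_sn:
  assumes "list_all2 (wd_tm ds) es \<sigma>"
  shows "\<sigma> \<in> sn red_sub"
proof -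
  have "t \<in> sn red_tm" if "t \<in> set \<sigma>" for t
    using assms that wd_tm_sn by (auto simp: list_all2_conv_all_nth in_set_conv_nth)
  then have "\<sigma> \<in> Wellfounded.acc (listrel1 {(t', t). red_tm t t'})"
    by (intro lists_accD) (auto simp: in_lists_conv_set)
  moreover have "{(\<tau>, \<sigma>). red_sub \<sigma> \<tau>} \<subseteq> listrel1 {(t', t). red_tm t t'}"
    by (auto elim!: red_sub.cases intro!: listrel1I)
  ultimately show ?thesis using acc_subset by blast
qed

section \<open>Well-typed terms are dimension-typed\<close>

lemma wd_tree_ctx: "A \<in> set (tree_ctx T) \<Longrightarrow> wd_ty (tree_dims T) A"
proof (induction T arbitrary: A rule: tree_ctx.induct)
  case (2 T Ts)
  let ?\<Gamma> = "susp_ctx (tree_ctx T)" and ?\<Delta> = "tree_ctx (Tree Ts)"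
  have dims: "tree_dims (Tree (T # Ts)) = map ty_dim (wedge ?\<Gamma> ?\<Delta>)"
    using dims_tree_ctx[of "Tree (T # Ts)"] by simp
  from 2(3) consider "A \<in> set ?\<Gamma>"
    | B where "B \<in> set (tl ?\<Delta>)" "A = sub_ty B (wedge_inr_sub ?\<Gamma> ?\<Delta>)"
    by (auto simp: wedge_def)
  then show ?case
  proof cases
    case 1
    then have "wd_ty (0 # 0 # map Suc (tree_dims T)) A"
      by (auto simp: susp_ctx_def intro: wd_ty_susp 2(1))
    then show ?thesis unfolding dims dims_wedge dims_susp_ctx dims_tree_ctx by (rule wd_ty_append)
  next
    case 2
    then have "B \<in> set ?\<Delta>" by (metis list.set_sel(2) tl_Nil)
    then have "wd_ty (map ty_dim ?\<Delta>) B" unfolding dims_tree_ctx by (rule "2.IH"(2))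
    then show ?thesis
      unfolding dims 2(2)
      by (rule wd_ty_sub) (rule vars_of_wd[OF vars_of_wedge_inr_sub[OF pointed_susp_ctx pointed_tree_ctx]])
  qed
qed simp

text \<open>Closing downwards stays within the bound, because the variables in the type of
  \<open>x\<close> have smaller dimension than \<open>x\<close>.\<close>

lemma supp_dim:
  assumes "wd_tm (tree_dims T) n t" "x \<in> supp_tm (tree_ctx T) t"
  shows "x < length (tree_dims T) \<and> tree_dims T ! x \<le> n"
  using assms(2) unfolding supp_tm_def
proof (induction rule: down_closure.induct)
  case (base x)
  then show ?case using wd_tm_fv[OF assms(1)] by blast
next
  case (down x y)
  then have "wd_ty (tree_dims T) (tree_ctx T ! x)" by (intro wd_tree_ctx) simp
  from wd_ty_fv[OF this down(3)] down nth_tree_dims[of x T] show ?case by simp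
qed

lemma tree_dim_le_full:
  assumes "wd_tm (tree_dims T) n t" "supp_tm (tree_ctx T) t = {..<length (tree_ctx T)}"
  shows "tree_dim T \<le> n"
proof -
  obtain x where "x < length (tree_dims T)" "tree_dims T ! x = tree_dim T"
    using tree_dim_in_tree_dims[of T] by (auto simp: in_set_conv_nth)
  then show ?thesis using supp_dim[OF assms(1), of x] assms(2) by simp
qed

text \<open>The boundary contains a variable of dimension \<open>m\<close>, so the support condition
  forces \<open>m \<le> n\<close>. The bound \<open>Suc n\<close> is the dimension of the arrow
  whose source or target is \<open>t\<close>.\<close>

lemma tree_dim_le_boundary:
  assumes "wd_tm (tree_dims T) n t" "tree_dim T = Suc m"
    and "supp_tm (tree_ctx T) t = supp_sub (tree_ctx T) (bdry_incl \<epsilon> m T)"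
  shows "tree_dim T \<le> Suc n"
proof -
  have "m \<in> set (tree_dims T)"
    using tree_dim_in_tree_dims[of T] unfolding assms(2) by (rule tree_dims_down)
  then have "m \<in> set (tree_dims (bdry m T))" by (intro tree_dims_bdry) simp
  then obtain j where "j < length (tree_dims (bdry m T))" "tree_dims (bdry m T) ! j = m"
    by (auto simp: in_set_conv_nth)
  then obtain i where i: "i < length (tree_dims T)" "bdry_incl \<epsilon> m T ! j = Var i" "tree_dims T ! i = m"
    and "j < length (bdry_incl \<epsilon> m T)"
    using vars_of_bdry_incl[of T m \<epsilon>] by (auto simp: list_all2_conv_all_nth var_of_def)
  then have "Var i \<in> set (bdry_incl \<epsilon> m T)" by (metis nth_mem)
  then have "i \<in> supp_sub (tree_ctx T) (bdry_incl \<epsilon> m T)"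
    unfolding supp_sub_def by (intro down_closure.base) force
  then show ?thesis using supp_dim[OF assms(1), of i] assms(2,3) i by simp
qed

lemma wd_typed_Coh:
  assumes "wd_ty (tree_dims T) (Arr s A t)" "list_all2 (wd_tm ds) (tree_dims T) \<sigma>"
    and "tree_dim T \<le> Suc (ty_dim A)"
  shows "wd_tm ds (Suc (ty_dim A)) (Coh (tree_ctx T) (Arr s A t) \<sigma>)"
proof -
  have "\<forall>B \<in> set (tree_ctx T). ty_dim B \<le> Suc (ty_dim A)"
    using tree_dims_bound[OF ty_dim_in_tree_dims] assms(3) order_trans by blast
  then show ?thesis using assms by simp
qed

text \<open>Equality enters typing through conversion, for which it suffices that equal types have
  the same number of arrows. Either support condition bounds the dimension of the context of a
  coherence by that of its type, which is the main clause of \<open>wd_Coh\<close>.\<close>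

lemma
  shows "wf_ctx \<Gamma> \<Longrightarrow> True"
    and wf_ty_wd: "wf_ty \<Gamma> A \<Longrightarrow> wd_ty (map ty_dim \<Gamma>) A"
    and wf_tm_wd: "wf_tm \<Gamma> t A \<Longrightarrow> wd_tm (map ty_dim \<Gamma>) (ty_dim A) t"
    and wf_sub_wd: "wf_sub \<Gamma> \<sigma> \<Delta> \<Longrightarrow> list_all2 (wd_tm (map ty_dim \<Gamma>)) (map ty_dim \<Delta>) \<sigma>"
    and eq_ty_dim: "eq_ty \<Gamma> A B \<Longrightarrow> ty_dim A = ty_dim B"
    and "eq_tm \<Gamma> s t \<Longrightarrow> True"
    and "eq_sub \<Gamma> \<sigma> \<tau> \<Longrightarrow> True"
proof (induction rule: wf_ctx_wf_ty_wf_tm_wf_sub_eq_ty_eq_tm_eq_sub.inducts)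
  case (sub_ext \<Delta> \<sigma> \<Gamma> A t)
  then show ?case by (auto intro: list_all2_appendI)
next
  case (tm_coh_comp \<Delta> T s A t \<Gamma> \<sigma>)
  have "wd_tm (tree_dims T) (ty_dim A) s" using tm_coh_comp by simp
  moreover obtain m where "tree_dim T = Suc m"
    using tm_coh_comp by (cases "tree_dim T") (auto simp: ctx_dim_tree_ctx)
  ultimately have "tree_dim T \<le> Suc (ty_dim A)"
    using tm_coh_comp by (intro tree_dim_le_boundary) (auto simp: ctx_dim_tree_ctx)
  then show ?case using tm_coh_comp wd_typed_Coh[of T s A t] by simp
next
  case (tm_coh_full \<Delta> s A t \<Gamma> \<sigma>)
  then obtain T where T: "\<Delta> = tree_ctx T" by (auto simp: pasting_def)
  then have "wd_tm (tree_dims T) (ty_dim A) s" using tm_coh_full by simp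
  then have "tree_dim T \<le> ty_dim A" using tm_coh_full T by (intro tree_dim_le_full) simp_all
  then show ?case using tm_coh_full T wd_typed_Coh[of T s A t] by simp
qed simp_all

theorem corollary42:
  shows "(\<forall>\<Gamma> s A. wf_tm \<Gamma> s A \<longrightarrow>
            \<not> (\<exists>f :: nat \<Rightarrow> tm. f 0 = s \<and> (\<forall>i. red_tm (f i) (f (Suc i)))))
       \<and> (\<forall>\<Gamma> A. wf_ty \<Gamma> A \<longrightarrow>
            \<not> (\<exists>f :: nat \<Rightarrow> ty. f 0 = A \<and> (\<forall>i. red_ty (f i) (f (Suc i)))))
       \<and> (\<forall>\<Gamma> \<sigma> \<Delta>. wf_sub \<Gamma> \<sigma> \<Delta> \<longrightarrow>
            \<not> (\<exists>f :: nat \<Rightarrow> sub. f 0 = \<sigma> \<and> (\<forall>i. red_sub (f i) (f (Suc i)))))"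
  using sn_no_infinite_chain[OF wd_tm_sn[OF wf_tm_wd]]
    sn_no_infinite_chain[OF wd_ty_sn[OF wf_ty_wd]]
    sn_no_infinite_chain[OF wd_sub_sn[OF wf_sub_wd]]
  by blast

end
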